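(* Let $g\ge1$ and $r\geq2$ be integers. Let $\Delta_3(g,r)$ be the set of $m=(m_0,\dots,m_r)\in\Delta(g,r)$ such that $m_l\neq0$ for at most one index $l\in\{2,\dots,r\}$. Then $\{\Theta_m:m\in\Delta_3(g,r)\}$ is a transcendence basis of $\mathrm{Frac}(\mathbb K[T,\dots,T^{(r)}]^{\mathbf{SL}_g})$ over $\mathbb K$.
   Context: $\mathbb K$ is an algebraically closed field. $\mathbb K[T,\dots,T^{(r)}]$ is the polynomial ring in entries $T^{(l)}_{ij}=T^{(l)}_{ji}$ ($1\le i\le j\le g$, $0\le l\le r$) of symmetric $g\times g$ matrices $T^{(l)}$, with $\mathbf{SL}_g$ acting by $T^{(l)}\mapsto\Lambda^{-1}T^{(l)}(\Lambda^{-1})^t$. $\Delta(g,r)=\{(m_0,\dots,m_r)\in\mathbb Z_{\ge0}^{r+1}:\sum m_i=g\}$ and $\Theta_m$ are defined by $\det(\sum_{i=0}^ry_iT^{(i)})=\sum_{m\in\Delta(g,r)}(\prod_iy_i^{m_i})\Theta_m$ with indeterminates $y_i$. *)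

theory Defs
  imports
    "HOL-Library.Poly_Mapping"
    "HOL-Computational_Algebra.Polynomial_Factorial"
    "Jordan_Normal_Form.Determinant"
    "Jordan_Normal_Form.Gauss_Jordan_Elimination"
begin

section \<open>Multivariate polynomials\<close>

text \<open>
  A polynomial with variables in \<open>'v\<close> and coefficients in \<open>'a\<close> is a finitely supported map
  from monomials (exponent vectors) to coefficients; multiplication on
  \<^typ>\<open>('v \<Rightarrow>\<^sub>0 nat) \<Rightarrow>\<^sub>0 'a\<close> is convolution.
\<close>

type_synonym ('v, 'a) mpoly = "('v \<Rightarrow>\<^sub>0 nat) \<Rightarrow>\<^sub>0 'a"

definition Const :: "'a::zero \<Rightarrow> ('v, 'a) mpoly" where
  "Const c = Poly_Mapping.single 0 c"

definition Var :: "'v \<Rightarrow> ('v, 'a::zero_neq_one) mpoly" where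
  "Var v = Poly_Mapping.single (Poly_Mapping.single v 1) 1"

definition vars :: "('v, 'a::zero) mpoly \<Rightarrow> 'v set" where
  "vars p = (\<Union>m\<in>Poly_Mapping.keys p. Poly_Mapping.keys m)"

text \<open>Evaluation at \<open>f\<close>, with coefficients mapped into the target ring by \<open>\<phi>\<close>.\<close>

definition eval_mpoly ::
  "('a::zero \<Rightarrow> 'b::comm_semiring_1) \<Rightarrow> ('v \<Rightarrow> 'b) \<Rightarrow> ('v, 'a) mpoly \<Rightarrow> 'b" where
  "eval_mpoly \<phi> f p =
     (\<Sum>m\<in>Poly_Mapping.keys p. \<phi> (Poly_Mapping.lookup p m) *
        (\<Prod>v\<in>Poly_Mapping.keys m. f v ^ Poly_Mapping.lookup m v))"


section \<open>Transcendence bases\<close>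

definition is_subfield :: "'f::field set \<Rightarrow> bool" where
  "is_subfield S \<longleftrightarrow> 0 \<in> S \<and> 1 \<in> S \<and>
     (\<forall>x\<in>S. \<forall>y\<in>S. x + y \<in> S \<and> x * y \<in> S) \<and>
     (\<forall>x\<in>S. - x \<in> S \<and> inverse x \<in> S)"

definition algebraic_over :: "'f::field set \<Rightarrow> 'f \<Rightarrow> bool" where
  "algebraic_over S x \<longleftrightarrow> (\<exists>q. q \<noteq> 0 \<and> (\<forall>i. poly.coeff q i \<in> S) \<and> poly q x = 0)"

text \<open>
  In the following definitions the ground field is embedded into the ambient field by \<open>\<phi>\<close>.
  The elements of \<open>B\<close> themselves serve as names of the variables.
\<close>

definition algebraically_independent ::
  "('k::field \<Rightarrow> 'f::field) \<Rightarrow> 'f set \<Rightarrow> bool" where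
  "algebraically_independent \<phi> B \<longleftrightarrow>
     (\<forall>p :: ('f, 'k) mpoly. vars p \<subseteq> B \<longrightarrow> eval_mpoly \<phi> (\<lambda>b. b) p = 0 \<longrightarrow> p = 0)"

definition transcendence_basis ::
  "('k::field \<Rightarrow> 'f::field) \<Rightarrow> 'f set \<Rightarrow> 'f set \<Rightarrow> bool" where
  "transcendence_basis \<phi> L B \<longleftrightarrow>
     B \<subseteq> L \<and> algebraically_independent \<phi> B \<and>
     (\<forall>x\<in>L. algebraic_over (is_subfield hull (range \<phi> \<union> B)) x)"

text \<open>The fraction field of a subring \<open>R\<close> of a domain, inside the fraction field of the domain.\<close>

definition Frac :: "'a::idom set \<Rightarrow> 'a fract set" where
  "Frac R = {Fraction_Field.Fract p q | p q. p \<in> R \<and> q \<in> R \<and> q \<noteq> 0}"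


section \<open>Invariants of tuples of symmetric matrices\<close>

text \<open>
  \<open>TVar l i j\<close> is the \<open>(i, j)\<close> entry of the \<open>l\<close>-th matrix, with row and column indices starting
  at \<open>0\<close>. Only those with \<open>i \<le> j\<close> are used as variables. The linear order is there only because
  the library's \<^class>\<open>idom\<close> instance for polynomials asks for one on the variables.
\<close>

datatype tvar = TVar nat nat nat

instantiation tvar :: linorder
begin

fun less_eq_tvar :: "tvar \<Rightarrow> tvar \<Rightarrow> bool" where
  "TVar l i j \<le> TVar l' i' j' \<longleftrightarrow> l < l' \<or> l = l' \<and> (i < i' \<or> i = i' \<and> j \<le> j')"

definition less_tvar :: "tvar \<Rightarrow> tvar \<Rightarrow> bool" where
  "x < y \<longleftrightarrow> x \<le> y \<and> \<not> y \<le> (x :: tvar)"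

instance
proof
  fix x y z :: tvar
  show "x < y \<longleftrightarrow> x \<le> y \<and> \<not> y \<le> x" by (rule less_tvar_def)
  show "x \<le> x" by (cases x) simp
  show "x \<le> y \<Longrightarrow> y \<le> z \<Longrightarrow> x \<le> z" by (cases x; cases y; cases z) auto
  show "x \<le> y \<Longrightarrow> y \<le> x \<Longrightarrow> x = y" by (cases x; cases y) auto
  show "x \<le> y \<or> y \<le> x" by (cases x; cases y) auto
qed

end

definition tvars :: "nat \<Rightarrow> nat \<Rightarrow> tvar set" where
  "tvars g r = {TVar l i j | l i j. l \<le> r \<and> i \<le> j \<and> j < g}"

definition T_ring :: "nat \<Rightarrow> nat \<Rightarrow> (tvar, 'k::field) mpoly set" where
  "T_ring g r = {p. vars p \<subseteq> tvars g r}"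

definition T_mat :: "nat \<Rightarrow> nat \<Rightarrow> (tvar, 'k::field) mpoly mat" where
  "T_mat g l = mat g g (\<lambda>(i, j). Var (TVar l (min i j) (max i j)))"

definition SL :: "nat \<Rightarrow> 'k::field mat set" where
  "SL g = {\<Lambda> \<in> carrier_mat g g. det \<Lambda> = 1}"

definition SL_act ::
  "nat \<Rightarrow> 'k::field mat \<Rightarrow> (tvar, 'k) mpoly \<Rightarrow> (tvar, 'k) mpoly" where
  "SL_act g \<Lambda> p =
     (let N = map_mat Const (the (mat_inverse \<Lambda>))
      in eval_mpoly Const
           (\<lambda>v. case v of TVar l i j \<Rightarrow> (N * T_mat g l * transpose_mat N) $$ (i, j)) p)"

definition SL_invariants :: "nat \<Rightarrow> nat \<Rightarrow> (tvar, 'k::field) mpoly set" where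
  "SL_invariants g r = {p \<in> T_ring g r. \<forall>\<Lambda>\<in>SL g. SL_act g \<Lambda> p = p}"

definition Delta :: "nat \<Rightarrow> nat \<Rightarrow> (nat \<Rightarrow>\<^sub>0 nat) set" where
  "Delta g r = {m. Poly_Mapping.keys m \<subseteq> {..r} \<and> (\<Sum>i\<le>r. Poly_Mapping.lookup m i) = g}"

definition Delta3 :: "nat \<Rightarrow> nat \<Rightarrow> (nat \<Rightarrow>\<^sub>0 nat) set" where
  "Delta3 g r = {m \<in> Delta g r.
     \<forall>l\<in>{2..r}. \<forall>l'\<in>{2..r}.
       Poly_Mapping.lookup m l \<noteq> 0 \<longrightarrow> Poly_Mapping.lookup m l' \<noteq> 0 \<longrightarrow> l = l'}"

text \<open>The matrix \<open>\<Sum>i\<le>r. y\<^sub>i T\<^sup>(\<^sup>i\<^sup>)\<close> over the polynomial ring in the \<open>y\<^sub>i\<close> over \<open>\<bbbK>[T, \<dots>, T\<^sup>(\<^sup>r\<^sup>)]\<close>.\<close>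

definition yT_mat :: "nat \<Rightarrow> nat \<Rightarrow> (nat, (tvar, 'k::field) mpoly) mpoly mat" where
  "yT_mat g r = mat g g (\<lambda>(i, j). \<Sum>l\<le>r. Var l * Const (T_mat g l $$ (i, j)))"

definition Theta :: "nat \<Rightarrow> nat \<Rightarrow> (nat \<Rightarrow>\<^sub>0 nat) \<Rightarrow> (tvar, 'k::field) mpoly" where
  "Theta g r m = Poly_Mapping.lookup (det (yT_mat g r)) m"

subsection \<open>The expansion of the determinant\<close>

lemma keys_yT_mat_entry:
  assumes "i < g" "j < g" "m \<in> Poly_Mapping.keys (yT_mat g r $$ (i, j))"
  shows "m \<in> Delta 1 r"
proof -
  have "m \<in> (\<Union>l\<in>{..r}. Poly_Mapping.keys (Var l * Const (T_mat g l $$ (i, j)) :: (nat, (tvar, 'a) mpoly) mpoly))"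
    using assms keys_sum[of "\<lambda>l. Var l * Const (T_mat g l $$ (i, j)) :: (nat, (tvar, 'a) mpoly) mpoly" "{..r}"]
    by (auto simp: yT_mat_def)
  then obtain l where l: "l \<le> r" "m = Poly_Mapping.single l 1"
    by (auto simp: Var_def Const_def mult_single split: if_splits)
  then show ?thesis
    by (auto simp: Delta_def lookup_single when_def)
qed

lemma Delta_add: "a \<in> Delta d r \<Longrightarrow> b \<in> Delta e r \<Longrightarrow> a + b \<in> Delta (d + e) r"
  using keys_add[of a b] by (auto simp: Delta_def lookup_add sum.distrib)

lemma keys_prod_Delta:
  fixes f :: "nat \<Rightarrow> (nat, 'b::comm_ring_1) mpoly"
  assumes "\<And>i. i < n \<Longrightarrow> Poly_Mapping.keys (f i) \<subseteq> Delta 1 r"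
  shows "Poly_Mapping.keys (\<Prod>i = 0..<n. f i) \<subseteq> Delta n r"
  using assms
proof (induction n)
  case 0
  then show ?case by (simp add: Delta_def)
next
  case (Suc n)
  have "Poly_Mapping.keys (\<Prod>i = 0..<n. f i) \<subseteq> Delta n r"
    using Suc by simp
  moreover have "Poly_Mapping.keys (f n) \<subseteq> Delta 1 r"
    using Suc.prems by simp
  ultimately show ?case
    using keys_mult[of "\<Prod>i = 0..<n. f i" "f n"] Delta_add[of _ n r _ 1] by fastforce
qed

lemma keys_det_yT_mat: "Poly_Mapping.keys (det (yT_mat g r)) \<subseteq> Delta g r"
proof -
  have "Poly_Mapping.keys (signof p * (\<Prod>i = 0..<g. yT_mat g r $$ (i, p i)) :: (nat, (tvar, 'a) mpoly) mpoly)
          \<subseteq> Delta g r" if "p permutes {0..<g}" for p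
  proof -
    have "Poly_Mapping.keys (\<Prod>i = 0..<g. yT_mat g r $$ (i, p i) :: (nat, (tvar, 'a) mpoly) mpoly) \<subseteq> Delta g r"
    proof (rule keys_prod_Delta)
      fix i assume "i < g"
      moreover from this have "p i < g"
        using permutes_in_image[OF that, of i] by simp
      ultimately show "Poly_Mapping.keys (yT_mat g r $$ (i, p i) :: (nat, (tvar, 'a) mpoly) mpoly) \<subseteq> Delta 1 r"
        using keys_yT_mat_entry by blast
    qed
    then show ?thesis
      by (auto simp: sign_def in_keys_iff subset_iff split: if_splits)
  qed
  moreover have "(yT_mat g r :: (nat, (tvar, 'a) mpoly) mpoly mat) \<in> carrier_mat g g"
    by (simp add: yT_mat_def)
  ultimately show ?thesis
    using keys_sum[of "\<lambda>p. signof p * (\<Prod>i = 0..<g. yT_mat g r $$ (i, p i)) :: (nat, (tvar, 'a) mpoly) mpoly"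
        "{p. p permutes {0..<g}}"]
    by (subst det_def') (assumption, blast)
qed

lemma Var_power: "(Var v :: ('v, 'b::comm_ring_1) mpoly) ^ n = Poly_Mapping.single (Poly_Mapping.single v n) 1"
  by (induction n) (simp_all add: Var_def mult_single single_add[symmetric] single_one)

lemma prod_Var_power:
  assumes "finite A"
  shows "(\<Prod>i\<in>A. (Var i :: ('v, 'b::comm_ring_1) mpoly) ^ f i)
           = Poly_Mapping.single (\<Sum>i\<in>A. Poly_Mapping.single i (f i)) 1"
  using assms by induction (simp_all add: Var_power mult_single single_one)

lemma Delta_monomial:
  assumes "m \<in> Delta g r"
  shows "(\<Sum>i\<le>r. Poly_Mapping.single i (Poly_Mapping.lookup m i)) = m"
proof (rule poly_mapping_eqI)
  fix k
  show "Poly_Mapping.lookup (\<Sum>i\<le>r. Poly_Mapping.single i (Poly_Mapping.lookup m i)) k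
          = Poly_Mapping.lookup m k"
    using assms in_keys_iff[of k m]
    by (auto simp: Delta_def lookup_sum lookup_single when_def)
qed

lemma finite_Delta: "finite (Delta g r)"
proof (rule finite_subset)
  show "Delta g r \<subseteq> (\<lambda>f. \<Sum>i\<le>r. Poly_Mapping.single i (f i)) ` ({..r} \<rightarrow>\<^sub>E {..g})"
  proof
    fix m assume m: "m \<in> Delta g r"
    have "Poly_Mapping.lookup m i \<le> g" if "i \<le> r" for i
      using m member_le_sum[of i "{..r}" "Poly_Mapping.lookup m"] that by (auto simp: Delta_def)
    then have "restrict (Poly_Mapping.lookup m) {..r} \<in> {..r} \<rightarrow>\<^sub>E {..g}"
      by auto
    moreover have "m = (\<Sum>i\<le>r. Poly_Mapping.single i (restrict (Poly_Mapping.lookup m) {..r} i))"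
      using Delta_monomial[OF m] by simp
    ultimately show "m \<in> (\<lambda>f. \<Sum>i\<le>r. Poly_Mapping.single i (f i)) ` ({..r} \<rightarrow>\<^sub>E {..g})"
      by blast
  qed
qed (simp add: finite_PiE)

lemma det_yT_mat_expansion:
  "det (yT_mat g r) =
     (\<Sum>m\<in>Delta g r. (\<Prod>i\<le>r. Var i ^ Poly_Mapping.lookup m i) * Const (Theta g r m))"
proof (rule poly_mapping_eqI)
  fix k :: "nat \<Rightarrow>\<^sub>0 nat"
  have "Poly_Mapping.lookup (\<Sum>m\<in>Delta g r. (\<Prod>i\<le>r. Var i ^ Poly_Mapping.lookup m i) *
            Const (Theta g r m) :: (nat, (tvar, 'a) mpoly) mpoly) k
      = (\<Sum>m\<in>Delta g r. Poly_Mapping.lookup (Poly_Mapping.single m (Theta g r m)) k)"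
    unfolding lookup_sum
    by (intro sum.cong refl) (simp add: prod_Var_power Delta_monomial Const_def mult_single)
  also have "\<dots> = (if k \<in> Delta g r then Theta g r k else 0)"
    by (simp add: lookup_single when_def finite_Delta)
  also have "\<dots> = Poly_Mapping.lookup (det (yT_mat g r)) k"
    using keys_det_yT_mat[of g r, where 'a = 'a] by (auto simp: Theta_def in_keys_iff)
  finally show "Poly_Mapping.lookup (det (yT_mat g r)) k =
      Poly_Mapping.lookup (\<Sum>m\<in>Delta g r. (\<Prod>i\<le>r. Var i ^ Poly_Mapping.lookup m i) *
            Const (Theta g r m) :: (nat, (tvar, 'a) mpoly) mpoly) k"
    by (rule sym)
qed

end

theory Submission
  imports Defs
begin

text \<open>
  Algebraic independence: put \<open>T\<^sup>(\<^sup>0\<^sup>)\<close> and \<open>T\<^sup>(\<^sup>1\<^sup>)\<close> in diagonal form and multiply the entries of the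
  matrices by suitable powers of \<open>t\<close>. The leading term of \<open>\<Theta>\<^sub>m\<close> is then a single monomial, in which
  the first \<open>m\<^sub>1\<close> rows come from \<open>T\<^sup>(\<^sup>1\<^sup>)\<close>, the last \<open>m\<^sub>0\<close> rows from \<open>T\<^sup>(\<^sup>0\<^sup>)\<close>, and the rows between them
  contribute the antidiagonal of a contiguous principal block of \<open>T\<^sup>(\<^sup>l\<^sup>)\<close>. Over an algebraically closed field
  these monomials take any prescribed nonzero values simultaneously, so no polynomial
  relation can hold between the \<open>\<Theta>\<^sub>m\<close>.

  Algebraicity: an invariant is determined by its restriction to the slice on which \<open>T\<^sup>(\<^sup>0\<^sup>)\<close> is
  scalar and \<open>T\<^sup>(\<^sup>1\<^sup>)\<close> diagonal, because the pairs \<open>(L L\<^sup>t, L D L\<^sup>t)\<close> are dense among all pairs of symmetric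
  matrices; this follows from the same leading term argument, in every characteristic. The
  slice has as many coordinates as there are elements of \<open>\<Delta>\<^sub>3(g, r)\<close>. Counting monomials on the slice
  then gives a relation between the numerator and the denominator of an invariant
  fraction and the \<open>\<Theta>\<^sub>m\<close>.
\<close>

section \<open>Evaluation of monomials and polynomials\<close>

definition monom_eval :: "('v \<Rightarrow> 'b::comm_semiring_1) \<Rightarrow> ('v \<Rightarrow>\<^sub>0 nat) \<Rightarrow> 'b" where
  "monom_eval f m = (\<Prod>v\<in>Poly_Mapping.keys m. f v ^ Poly_Mapping.lookup m v)"

lemma eval_mpoly_monom_eval:
  "eval_mpoly \<phi> f p =
     (\<Sum>m\<in>Poly_Mapping.keys p. \<phi> (Poly_Mapping.lookup p m) * monom_eval f m)"
  by (simp add: eval_mpoly_def monom_eval_def)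

lemma monom_eval_superset:
  assumes "finite A" "Poly_Mapping.keys m \<subseteq> A"
  shows "monom_eval f m = (\<Prod>v\<in>A. f v ^ Poly_Mapping.lookup m v)"
  unfolding monom_eval_def using assms
  by (intro prod.mono_neutral_left) (auto simp: in_keys_iff)

lemma monom_eval_0 [simp]: "monom_eval f 0 = 1"
  by (simp add: monom_eval_def)

lemma monom_eval_single [simp]: "monom_eval f (Poly_Mapping.single v n) = f v ^ n"
  by (simp add: monom_eval_def)

lemma monom_eval_add: "monom_eval f (m + n) = monom_eval f m * monom_eval f n"
proof -
  let ?A = "Poly_Mapping.keys m \<union> Poly_Mapping.keys n"
  have "monom_eval f (m + n) = (\<Prod>v\<in>?A. f v ^ Poly_Mapping.lookup (m + n) v)"
    by (intro monom_eval_superset) (use keys_add[of m n] in auto)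
  also have "\<dots> = (\<Prod>v\<in>?A. f v ^ Poly_Mapping.lookup m v) * (\<Prod>v\<in>?A. f v ^ Poly_Mapping.lookup n v)"
    by (simp add: lookup_add power_add prod.distrib)
  also have "\<dots> = monom_eval f m * monom_eval f n"
    by (simp add: monom_eval_superset[of ?A])
  finally show ?thesis .
qed

lemma (in comm_ring_hom) hom_monom_eval: "hom (monom_eval f m) = monom_eval (\<lambda>v. hom (f v)) m"
  by (simp add: monom_eval_def hom_distribs)

lemma eval_mpoly_superset:
  assumes "\<phi> 0 = 0" "finite A" "Poly_Mapping.keys p \<subseteq> A"
  shows "eval_mpoly \<phi> f p = (\<Sum>m\<in>A. \<phi> (Poly_Mapping.lookup p m) * monom_eval f m)"
  unfolding eval_mpoly_monom_eval using assms
  by (intro sum.mono_neutral_left) (auto simp: in_keys_iff)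

lemma sum_single_lookup:
  "(\<Sum>m\<in>Poly_Mapping.keys p. Poly_Mapping.single m (Poly_Mapping.lookup p m)) = p"
  by (rule poly_mapping_eqI) (auto simp: lookup_sum lookup_single when_def in_keys_iff)

lemma poly_mapping_induct [case_names zero single add]:
  fixes p :: "'v \<Rightarrow>\<^sub>0 'a::comm_monoid_add"
  assumes "P 0" "\<And>m c. P (Poly_Mapping.single m c)" "\<And>p q. P p \<Longrightarrow> P q \<Longrightarrow> P (p + q)"
  shows "P p"
proof -
  have "P (\<Sum>m\<in>A. Poly_Mapping.single m (Poly_Mapping.lookup p m))" if "finite A" for A
    using that by induction (use assms in auto)
  from this[of "Poly_Mapping.keys p"] show ?thesis by (simp add: sum_single_lookup)
qed

lemma comm_ring_hom_Const: "comm_ring_hom (Const :: 'a::comm_ring_1 \<Rightarrow> ('v, 'a) mpoly)"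
  by unfold_locales (simp_all add: Const_def single_add mult_single)

lemma comm_ring_hom_pCons: "comm_ring_hom (\<lambda>c :: 'a::comm_ring_1. [:c:])"
  by unfold_locales simp_all

lemma comm_ring_hom_id: "comm_ring_hom (\<lambda>c :: 'a::comm_ring_1. c)"
  by unfold_locales simp_all

lemma comm_ring_hom_poly: "comm_ring_hom (\<lambda>p :: 'a::comm_ring_1 poly. poly p t)"
  by unfold_locales simp_all

lemma comm_ring_hom_to_fract: "comm_ring_hom (to_fract :: 'a::idom \<Rightarrow> _)"
  by unfold_locales simp_all

context comm_ring_hom
begin

lemma eval_mpoly_single: "eval_mpoly hom f (Poly_Mapping.single m c) = hom c * monom_eval f m"
  by (simp add: eval_mpoly_monom_eval)

lemma eval_mpoly_Const [simp]: "eval_mpoly hom f (Const c) = hom c"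
  by (simp add: Const_def eval_mpoly_single)

lemma eval_mpoly_Var [simp]: "eval_mpoly hom f (Var v) = f v"
  by (simp add: Var_def eval_mpoly_single)

lemma eval_mpoly_add: "eval_mpoly hom f (p + q) = eval_mpoly hom f p + eval_mpoly hom f q"
proof -
  let ?A = "Poly_Mapping.keys p \<union> Poly_Mapping.keys q"
  have "eval_mpoly hom f (p + q) = (\<Sum>m\<in>?A. hom (Poly_Mapping.lookup (p + q) m) * monom_eval f m)"
    by (intro eval_mpoly_superset) (use keys_add[of p q] in auto)
  also have "\<dots> = (\<Sum>m\<in>?A. hom (Poly_Mapping.lookup p m) * monom_eval f m)
      + (\<Sum>m\<in>?A. hom (Poly_Mapping.lookup q m) * monom_eval f m)"
    by (simp add: lookup_add hom_distribs distrib_right sum.distrib)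
  also have "\<dots> = eval_mpoly hom f p + eval_mpoly hom f q"
    by (simp add: eval_mpoly_superset[where A = ?A])
  finally show ?thesis .
qed

lemma eval_mpoly_mult: "eval_mpoly hom f (p * q) = eval_mpoly hom f p * eval_mpoly hom f q"
proof (induction p rule: poly_mapping_induct)
  case zero
  then show ?case by (simp add: eval_mpoly_monom_eval)
next
  case (single m c)
  show ?case
  proof (induction q rule: poly_mapping_induct)
    case zero
    then show ?case by (simp add: eval_mpoly_monom_eval)
  next
    case (single n d)
    then show ?case
      by (simp add: mult_single eval_mpoly_single monom_eval_add hom_distribs mult_ac)
  next
    case (add p q)
    then show ?case by (simp add: distrib_left eval_mpoly_add)
  qed
next
  case (add p q)
  then show ?case by (simp add: distrib_right eval_mpoly_add)
qed

lemma comm_ring_hom_eval_mpoly: "comm_ring_hom (eval_mpoly hom f)"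
proof
  show "eval_mpoly hom f 0 = 0"
    by (simp add: eval_mpoly_monom_eval)
  show "eval_mpoly hom f 1 = 1"
    using eval_mpoly_Const[of f 1] by (simp add: Const_def)
qed (simp_all add: eval_mpoly_add eval_mpoly_mult)

lemma hom_eval_mpoly:
  assumes "\<And>c. hom (\<phi> c) = \<psi> c"
  shows "hom (eval_mpoly \<phi> f p) = eval_mpoly \<psi> (\<lambda>v. hom (f v)) p"
  by (simp add: eval_mpoly_monom_eval hom_distribs hom_monom_eval assms)

end

lemma eval_mpoly_cong:
  assumes "\<And>v. v \<in> vars p \<Longrightarrow> f v = f' v"
  shows "eval_mpoly \<phi> f p = eval_mpoly \<phi> f' p"
  unfolding eval_mpoly_def using assms
  by (intro sum.cong arg_cong2[where f = "(*)"] prod.cong refl) (force simp: vars_def)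

lemma eval_mpoly_eval_mpoly:
  assumes "comm_ring_hom (\<phi> :: 'a::comm_ring_1 \<Rightarrow> 'b::comm_ring_1)"
  shows "eval_mpoly \<phi> y (eval_mpoly Const s p) = eval_mpoly \<phi> (\<lambda>v. eval_mpoly \<phi> y (s v)) p"
proof -
  interpret \<phi>: comm_ring_hom \<phi> by fact
  interpret E: comm_ring_hom "eval_mpoly \<phi> y" by (rule \<phi>.comm_ring_hom_eval_mpoly)
  show ?thesis by (rule E.hom_eval_mpoly) simp
qed

lemma monom_eval_Var:
  "monom_eval Var m = (Poly_Mapping.single m 1 :: ('v, 'a::comm_ring_1) mpoly)"
proof -
  have "(\<Sum>v\<in>Poly_Mapping.keys m. Poly_Mapping.single v (Poly_Mapping.lookup m v)) = m"
    by (rule sum_single_lookup)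
  then show ?thesis by (simp add: monom_eval_def prod_Var_power)
qed

lemma eval_mpoly_Const_Var [simp]:
  "eval_mpoly Const Var p = (p :: ('v, 'a::comm_ring_1) mpoly)"
  by (simp add: eval_mpoly_monom_eval monom_eval_Var Const_def mult_single sum_single_lookup)

section \<open>Variables occurring in a polynomial\<close>

lemma vars_Const [simp]: "vars (Const c) = {}"
  by (simp add: vars_def Const_def)

lemma vars_0 [simp]: "vars 0 = {}"
  by (simp add: vars_def)

lemma vars_Var [simp]: "vars (Var v :: ('v, 'a::zero_neq_one) mpoly) = {v}"
  by (simp add: vars_def Var_def)

lemma vars_add: "vars (p + q) \<subseteq> vars p \<union> vars q"
  using keys_add[of p q] by (auto simp: vars_def)

lemma vars_uminus [simp]: "vars (- p :: ('v, 'a::ab_group_add) mpoly) = vars p"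
  by (auto simp: vars_def in_keys_iff)

lemma vars_mult: "vars (p * q) \<subseteq> vars p \<union> vars q"
proof
  fix v assume "v \<in> vars (p * q)"
  then obtain a b where "a \<in> Poly_Mapping.keys p" "b \<in> Poly_Mapping.keys q"
    "v \<in> Poly_Mapping.keys (a + b)"
    using keys_mult[of p q] by (auto simp: vars_def)
  then show "v \<in> vars p \<union> vars q"
    using keys_add[of a b] by (auto simp: vars_def)
qed

lemma vars_sum:
  assumes "\<And>i. i \<in> A \<Longrightarrow> vars (f i) \<subseteq> V"
  shows "vars (sum f A) \<subseteq> V"
  using assms
proof (induction A rule: infinite_finite_induct)
  case (insert x F)
  then show ?case using vars_add[of "f x" "sum f F"] by auto
qed auto

lemma vars_1 [simp]: "vars (1 :: ('v, 'a::zero_neq_one) mpoly) = {}"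
  by (simp add: vars_def)

lemma vars_prod:
  assumes "\<And>i. i \<in> A \<Longrightarrow> vars (f i :: ('v, 'a::comm_ring_1) mpoly) \<subseteq> V"
  shows "vars (prod f A) \<subseteq> V"
  using assms
proof (induction A rule: infinite_finite_induct)
  case (insert x F)
  then show ?case using vars_mult[of "f x" "prod f F"] by auto
qed auto

lemma vars_power: "vars (p ^ n :: ('v, 'a::comm_ring_1) mpoly) \<subseteq> vars p"
  using vars_prod[of "{..<n}" "\<lambda>_. p" "vars p"] by simp

lemma vars_eval_mpoly:
  assumes "\<And>v. v \<in> vars p \<Longrightarrow> vars (s v :: ('w, 'a::comm_ring_1) mpoly) \<subseteq> V"
  shows "vars (eval_mpoly Const s p) \<subseteq> V"
  unfolding eval_mpoly_def
proof (rule vars_sum)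
  fix m assume m: "m \<in> Poly_Mapping.keys p"
  have "vars (\<Prod>v\<in>Poly_Mapping.keys m. s v ^ Poly_Mapping.lookup m v) \<subseteq> V"
  proof (rule vars_prod)
    fix v assume "v \<in> Poly_Mapping.keys m"
    then have "v \<in> vars p" using m by (auto simp: vars_def)
    then show "vars (s v ^ Poly_Mapping.lookup m v) \<subseteq> V"
      using assms vars_power[of "s v"] by (meson order_trans)
  qed
  then show "vars (Const (Poly_Mapping.lookup p m) *
      (\<Prod>v\<in>Poly_Mapping.keys m. s v ^ Poly_Mapping.lookup m v)) \<subseteq> V"
    using vars_mult by fastforce
qed

section \<open>Leading terms along curves\<close>

text \<open>If the field were finite, the product of all X - a, increased by 1, would have positive
  degree but take the value 1 everywhere.\<close>

lemma infinite_UNIV_alg_closed: "infinite (UNIV :: 'k::alg_closed_field set)"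
proof
  assume fin: "finite (UNIV :: 'k set)"
  define p :: "'k poly" where "p = (\<Prod>a\<in>UNIV. [:- a, 1:]) + 1"
  have "degree (\<Prod>a\<in>(UNIV :: 'k set). [:- a, 1:]) = card (UNIV :: 'k set)"
    by (subst degree_prod_eq_sum_degree) auto
  moreover have "card (UNIV :: 'k set) > 0"
    using fin by (simp add: card_gt_0_iff)
  ultimately have "degree p > 0"
    unfolding p_def by (subst degree_add_eq_left) auto
  then obtain x where "poly p x = 0"
    using alg_closed_imp_poly_has_root by blast
  moreover have "poly p x = 1"
    using fin by (auto simp: p_def poly_prod intro!: prod_zero)
  ultimately show False by simp
qed

text \<open>Kronecker substitution, one variable at a time: x gets weight 1 and the weights found
  for the other variables are multiplied by an \<open>N\<close> above all exponents of x. The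
  exponent of x is then the total weight modulo \<open>N\<close>, and the quotient determines the
  remaining exponents \<open>d m\<close>.\<close>

lemma separating_weights:
  assumes "finite V" "finite S" "\<And>m. m \<in> S \<Longrightarrow> Poly_Mapping.keys m \<subseteq> V"
  shows "\<exists>w :: 'v \<Rightarrow> nat. inj_on (\<lambda>m. \<Sum>v\<in>V. Poly_Mapping.lookup m v * w v) S"
  using assms
proof (induction V arbitrary: S rule: finite_induct)
  case empty
  then show ?case by (auto simp: inj_on_def)
next
  case (insert x V)
  define d where "d m = Poly_Mapping.update x 0 m" for m :: "'v \<Rightarrow>\<^sub>0 nat"
  have d: "Poly_Mapping.lookup (d m) v = (if v = x then 0 else Poly_Mapping.lookup m v)" for m v
    by (simp add: d_def lookup_update)
  have "Poly_Mapping.keys m \<subseteq> V" if "m \<in> d ` S" for m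
    using that insert.prems by (force simp: d_def keys_update)
  then obtain w :: "'v \<Rightarrow> nat" where
    w: "inj_on (\<lambda>m. \<Sum>v\<in>V. Poly_Mapping.lookup m v * w v) (d ` S)"
    using insert.IH[of "d ` S"] insert.prems by auto
  define N where "N = Suc (Max ((\<lambda>m. Poly_Mapping.lookup m x) ` S))"
  have N: "Poly_Mapping.lookup m x < N" if "m \<in> S" for m
    using that insert.prems by (auto simp: N_def less_Suc_eq_le)
  define w' where "w' v = (if v = x then 1 else N * w v)" for v
  have wt: "(\<Sum>v\<in>insert x V. Poly_Mapping.lookup m v * w' v)
      = Poly_Mapping.lookup m x + N * (\<Sum>v\<in>V. Poly_Mapping.lookup (d m) v * w v)" for m
  proof -
    have "(\<Sum>v\<in>V. Poly_Mapping.lookup m v * w' v) = N * (\<Sum>v\<in>V. Poly_Mapping.lookup (d m) v * w v)"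
      unfolding sum_distrib_left using insert.hyps
      by (intro sum.cong) (auto simp: d w'_def)
    then show ?thesis using insert.hyps by (simp add: w'_def)
  qed
  have "inj_on (\<lambda>m. \<Sum>v\<in>insert x V. Poly_Mapping.lookup m v * w' v) S"
  proof (rule inj_onI)
    fix m n
    assume mn: "m \<in> S" "n \<in> S" and
      "(\<Sum>v\<in>insert x V. Poly_Mapping.lookup m v * w' v)
        = (\<Sum>v\<in>insert x V. Poly_Mapping.lookup n v * w' v)"
    then have eq: "Poly_Mapping.lookup m x + N * (\<Sum>v\<in>V. Poly_Mapping.lookup (d m) v * w v)
        = Poly_Mapping.lookup n x + N * (\<Sum>v\<in>V. Poly_Mapping.lookup (d n) v * w v)"
      by (simp only: wt)
    from arg_cong[OF eq, of "\<lambda>k. k mod N"] have x: "Poly_Mapping.lookup m x = Poly_Mapping.lookup n x"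
      using N mn by simp
    moreover have "N > 0" by (simp add: N_def)
    ultimately have "d m = d n"
      using eq w mn by (auto simp: inj_on_def)
    then show "m = n"
      by (intro poly_mapping_eqI) (metis d x)
  qed
  then show ?case by blast
qed

text \<open>Substituting t ^ \<open>w v\<close> for each variable v, with separating weights w,
  merges no two monomials of \<open>p\<close>. The result is a nonzero polynomial in t, and an
  infinite field contains some t \<noteq> 0 that is not a root of it.\<close>

lemma ex_nonzero_point_eval_ne_0:
  fixes p :: "('v, 'k::alg_closed_field) mpoly"
  assumes "p \<noteq> 0"
  obtains x where "\<And>v. x v \<noteq> 0" "eval_mpoly (\<lambda>c. c) x p \<noteq> 0"
proof -
  let ?V = "vars p"
  have fin: "finite ?V" by (simp add: vars_def)
  obtain w :: "'v \<Rightarrow> nat" where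
    w: "inj_on (\<lambda>m. \<Sum>v\<in>?V. Poly_Mapping.lookup m v * w v) (Poly_Mapping.keys p)"
    using separating_weights[OF fin, of "Poly_Mapping.keys p"] by (auto simp: vars_def)
  define wt where "wt m = (\<Sum>v\<in>?V. Poly_Mapping.lookup m v * w v)" for m
  define q where "q = (\<Sum>m\<in>Poly_Mapping.keys p. monom (Poly_Mapping.lookup p m) (wt m))"
  obtain m0 where m0: "m0 \<in> Poly_Mapping.keys p"
    using assms by (metis all_not_in_conv keys_eq_empty)
  have "poly.coeff q (wt m0) = (\<Sum>m\<in>Poly_Mapping.keys p. if m = m0 then Poly_Mapping.lookup p m0 else 0)"
    unfolding q_def coeff_sum
    using w m0 by (intro sum.cong) (auto simp: wt_def inj_on_def)
  also have "\<dots> \<noteq> 0" using m0 by (simp add: in_keys_iff)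
  finally have "q \<noteq> 0" by auto
  then have "finite ({t. poly q t = 0} \<union> {0})"
    using poly_roots_finite by auto
  then obtain t where "t \<notin> {t. poly q t = 0} \<union> {0}"
    using infinite_UNIV_alg_closed[where 'k = 'k] by (metis UNIV_eq_I)
  then have t: "t \<noteq> 0" "poly q t \<noteq> 0" by auto
  have "monom_eval (\<lambda>v. t ^ w v) m = t ^ wt m" if "m \<in> Poly_Mapping.keys p" for m
    using that
    by (subst monom_eval_superset[OF fin])
      (auto simp: vars_def wt_def power_sum power_mult[symmetric] mult.commute)
  then have "eval_mpoly (\<lambda>c. c) (\<lambda>v. t ^ w v) p = poly q t"
    by (simp add: eval_mpoly_monom_eval q_def poly_sum poly_monom)
  then show ?thesis using that[of "\<lambda>v. t ^ w v"] t by simp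
qed

text \<open>The bounds may exceed the degrees, so no top coefficient has to be nonzero. All other
  summands of the convolution have an index beyond one of the bounds.\<close>

lemma coeff_mult_degree_bounds:
  fixes p q :: "'a::comm_semiring_0 poly"
  assumes "degree p \<le> a" "degree q \<le> b"
  shows "poly.coeff (p * q) (a + b) = poly.coeff p a * poly.coeff q b"
proof -
  have "poly.coeff (p * q) (a + b) = (\<Sum>i\<le>a + b. poly.coeff p i * poly.coeff q (a + b - i))"
    by (simp add: coeff_mult)
  also have "\<dots> = (\<Sum>i\<in>{a}. poly.coeff p i * poly.coeff q (a + b - i))"
  proof (rule sum.mono_neutral_right)
    show "\<forall>i\<in>{..a + b} - {a}. poly.coeff p i * poly.coeff q (a + b - i) = 0"
    proof
      fix i assume "i \<in> {..a + b} - {a}"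
      then have "i > a \<or> a + b - i > b" by auto
      then show "poly.coeff p i * poly.coeff q (a + b - i) = 0"
        using assms by (auto simp: coeff_eq_0)
    qed
  qed auto
  finally show ?thesis by simp
qed

lemma degree_coeff_prod_bounds:
  fixes p :: "'i \<Rightarrow> 'a::comm_ring_1 poly"
  assumes "\<And>i. i \<in> A \<Longrightarrow> degree (p i) \<le> a i"
  shows "degree (prod p A) \<le> sum a A \<and> poly.coeff (prod p A) (sum a A) = (\<Prod>i\<in>A. poly.coeff (p i) (a i))"
  using assms
proof (induction A rule: infinite_finite_induct)
  case (insert x F)
  then have "degree (prod p F) \<le> sum a F" "degree (p x) \<le> a x"
    "poly.coeff (prod p F) (sum a F) = (\<Prod>i\<in>F. poly.coeff (p i) (a i))" by auto
  moreover from this have "degree (p x * prod p F) \<le> a x + sum a F"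
    using degree_mult_le[of "p x" "prod p F"] by linarith
  ultimately show ?case
    using insert.hyps by (simp add: coeff_mult_degree_bounds)
qed auto

text \<open>
  The part of \<open>f\<close> of top weight vanishes at every point with nonzero coordinates, because its
  value there is the leading coefficient of \<open>f\<close> along a suitable curve.
\<close>

lemma mpoly_eq_0_if_0_on_curves:
  fixes f :: "('v, 'k::alg_closed_field) mpoly" and e :: "'v \<Rightarrow> nat"
  assumes "\<And>\<tau>. (\<And>v. \<tau> v \<noteq> 0) \<Longrightarrow> \<exists>\<gamma>. (\<forall>v\<in>vars f. degree (\<gamma> v) \<le> e v \<and> poly.coeff (\<gamma> v) (e v) = \<tau> v)
                 \<and> eval_mpoly (\<lambda>c. [:c:]) \<gamma> f = 0"
  shows "f = 0"
proof (rule ccontr)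
  assume "f \<noteq> 0"
  define wt where "wt m = (\<Sum>v\<in>Poly_Mapping.keys m. Poly_Mapping.lookup m v * e v)" for m :: "'v \<Rightarrow>\<^sub>0 nat"
  define E where "E = Max (wt ` Poly_Mapping.keys f)"
  define S where "S = {m \<in> Poly_Mapping.keys f. wt m = E}"
  define h where "h = (\<Sum>m\<in>S. Poly_Mapping.single m (Poly_Mapping.lookup f m))"
  have finS: "finite S" and Sf: "S \<subseteq> Poly_Mapping.keys f" by (auto simp: S_def)
  have wt_le: "wt m \<le> E" if "m \<in> Poly_Mapping.keys f" for m
    using that by (simp add: E_def)
  have "E \<in> wt ` Poly_Mapping.keys f"
    unfolding E_def using \<open>f \<noteq> 0\<close> by (intro Max_in) auto
  then obtain m0 where m0: "m0 \<in> S" by (auto simp: S_def)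
  have lh: "Poly_Mapping.lookup h m = (if m \<in> S then Poly_Mapping.lookup f m else 0)" for m
    using finS by (simp add: h_def lookup_sum lookup_single when_def)
  have kh: "Poly_Mapping.keys h = S"
    using Sf by (auto simp: in_keys_iff lh split: if_splits)
  then have "h \<noteq> 0" using m0 by auto
  then obtain \<tau> where \<tau>: "\<And>v. \<tau> v \<noteq> 0" "eval_mpoly (\<lambda>c. c) \<tau> h \<noteq> 0"
    using ex_nonzero_point_eval_ne_0 by blast
  have "\<exists>\<gamma>. (\<forall>v\<in>vars f. degree (\<gamma> v) \<le> e v \<and> poly.coeff (\<gamma> v) (e v) = \<tau> v)
      \<and> eval_mpoly (\<lambda>c. [:c:]) \<gamma> f = 0"
    using \<tau>(1) by (rule assms)
  then obtain \<gamma> where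
    \<gamma>: "\<And>v. v \<in> vars f \<Longrightarrow> degree (\<gamma> v) \<le> e v" "\<And>v. v \<in> vars f \<Longrightarrow> poly.coeff (\<gamma> v) (e v) = \<tau> v"
    and z: "eval_mpoly (\<lambda>c. [:c:]) \<gamma> f = 0" by blast
  have mon: "degree (monom_eval \<gamma> m) \<le> wt m \<and> poly.coeff (monom_eval \<gamma> m) (wt m) = monom_eval \<tau> m"
    if m: "m \<in> Poly_Mapping.keys f" for m
  proof -
    have pw: "degree (\<gamma> v ^ k) \<le> k * e v \<and> poly.coeff (\<gamma> v ^ k) (k * e v) = \<tau> v ^ k"
      if "v \<in> Poly_Mapping.keys m" for v k
    proof -
      have "v \<in> vars f" using that m by (auto simp: vars_def)
      then show ?thesis
        using degree_coeff_prod_bounds[of "{..<k}" "\<lambda>_. \<gamma> v" "\<lambda>_. e v"] \<gamma> by simp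
    qed
    have "degree (monom_eval \<gamma> m) \<le> wt m \<and> poly.coeff (monom_eval \<gamma> m) (wt m)
        = (\<Prod>v\<in>Poly_Mapping.keys m. poly.coeff (\<gamma> v ^ Poly_Mapping.lookup m v) (Poly_Mapping.lookup m v * e v))"
      unfolding monom_eval_def wt_def using pw by (intro degree_coeff_prod_bounds) auto
    then show ?thesis using pw by (simp add: monom_eval_def)
  qed
  have "poly.coeff (eval_mpoly (\<lambda>c. [:c:]) \<gamma> f) E
      = (\<Sum>m\<in>Poly_Mapping.keys f. Poly_Mapping.lookup f m * poly.coeff (monom_eval \<gamma> m) E)"
    by (simp add: eval_mpoly_monom_eval coeff_sum)
  also have "\<dots> = (\<Sum>m\<in>S. Poly_Mapping.lookup f m * monom_eval \<tau> m)"
  proof (rule sum.mono_neutral_cong_right)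
    show "\<forall>m\<in>Poly_Mapping.keys f - S. Poly_Mapping.lookup f m * poly.coeff (monom_eval \<gamma> m) E = 0"
    proof
      fix m assume m: "m \<in> Poly_Mapping.keys f - S"
      then have "degree (monom_eval \<gamma> m) < E"
        using wt_le[of m] mon[of m] by (auto simp: S_def)
      then show "Poly_Mapping.lookup f m * poly.coeff (monom_eval \<gamma> m) E = 0"
        by (simp add: coeff_eq_0)
    qed
  qed (use Sf mon in \<open>auto simp: S_def\<close>)
  also have "\<dots> = eval_mpoly (\<lambda>c. c) \<tau> h"
    by (simp add: eval_mpoly_monom_eval kh lh)
  finally show False using z \<tau>(2) by simp
qed

section \<open>Mixed determinants\<close>

text \<open>This is the coefficient of y^m in the determinant of the matrix with entries \<Sum> y_l
  X_l(i, j), where \<open>\<phi> i\<close> is the matrix that supplies row i. Since each pair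
  (\<open>p\<close>, \<open>\<phi>\<close>) contributes one product of entries, leading terms can be
  found by comparing pairs.\<close>

definition mixdet :: "nat \<Rightarrow> nat \<Rightarrow> (nat \<Rightarrow> nat \<Rightarrow> nat \<Rightarrow> 'a::comm_ring_1) \<Rightarrow> (nat \<Rightarrow>\<^sub>0 nat) \<Rightarrow> 'a" where
  "mixdet g r X m =
     (\<Sum>p | p permutes {0..<g}.
        \<Sum>\<phi> | \<phi> \<in> {0..<g} \<rightarrow>\<^sub>E {..r} \<and> (\<Sum>i = 0..<g. Poly_Mapping.single (\<phi> i) 1) = m.
          signof p * (\<Prod>i = 0..<g. X (\<phi> i) i (p i)))"

lemma lookup_signof_mult:
  "Poly_Mapping.lookup (signof p * q :: ('v, 'a::comm_ring_1) mpoly) m = signof p * Poly_Mapping.lookup q m"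
  by (auto simp: sign_def)

lemma prod_single:
  "finite A \<Longrightarrow> (\<Prod>i\<in>A. Poly_Mapping.single (f i) (c i) :: ('v, 'a::comm_ring_1) mpoly)
     = Poly_Mapping.single (\<Sum>i\<in>A. f i) (\<Prod>i\<in>A. c i)"
  by (induction rule: finite_induct) (simp_all add: mult_single)

text \<open>Distributing the product over the rows of a Leibniz term gives one summand per labelling
  \<open>\<phi>\<close>; its exponent vector counts how often each label occurs.\<close>

lemma lookup_det_linear_combination:
  fixes X :: "nat \<Rightarrow> nat \<Rightarrow> nat \<Rightarrow> 'a::comm_ring_1"
  shows "Poly_Mapping.lookup (det (mat g g (\<lambda>(i, j). \<Sum>l\<le>r. Var l * Const (X l i j)))) m = mixdet g r X m"
proof -
  let ?M = "mat g g (\<lambda>(i, j). \<Sum>l\<le>r. Var l * Const (X l i j)) :: (nat, 'a) mpoly mat"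
  have prod: "(\<Prod>i = 0..<g. ?M $$ (i, p i)) =
      (\<Sum>\<phi>\<in>{0..<g} \<rightarrow>\<^sub>E {..r}. Poly_Mapping.single (\<Sum>i = 0..<g. Poly_Mapping.single (\<phi> i) 1)
          (\<Prod>i = 0..<g. X (\<phi> i) i (p i)))" if p: "p permutes {0..<g}" for p
  proof -
    have "(\<Prod>i = 0..<g. ?M $$ (i, p i)) = (\<Prod>i = 0..<g. \<Sum>l\<in>{..r}. Var l * Const (X l i (p i)))"
      using permutes_in_image[OF p] by (intro prod.cong) auto
    also have "\<dots> = (\<Sum>\<phi>\<in>{0..<g} \<rightarrow>\<^sub>E {..r}. \<Prod>i = 0..<g. Var (\<phi> i) * Const (X (\<phi> i) i (p i)))"
      by (rule prod_sum_PiE) auto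
    finally show ?thesis by (simp add: Var_def Const_def mult_single prod_single)
  qed
  have "Poly_Mapping.lookup (det ?M) m =
    (\<Sum>p | p permutes {0..<g}. signof p * Poly_Mapping.lookup (\<Prod>i = 0..<g. ?M $$ (i, p i)) m)"
    by (subst det_def'[of _ g]) (auto simp: lookup_sum lookup_signof_mult)
  also have "\<dots> = mixdet g r X m"
    unfolding mixdet_def
  proof (rule sum.cong[OF refl])
    fix p assume "p \<in> {p. p permutes {0..<g}}"
    then have p: "p permutes {0..<g}" by simp
    show "signof p * Poly_Mapping.lookup (\<Prod>i = 0..<g. ?M $$ (i, p i)) m
      = (\<Sum>\<phi> | \<phi> \<in> {0..<g} \<rightarrow>\<^sub>E {..r} \<and> (\<Sum>i = 0..<g. Poly_Mapping.single (\<phi> i) 1) = m.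
          signof p * (\<Prod>i = 0..<g. X (\<phi> i) i (p i)))"
      unfolding prod[OF p]
      by (simp add: lookup_sum lookup_single when_def sum_distrib_left[symmetric]
          sum.inter_filter[symmetric] finite_PiE)
  qed
  finally show ?thesis .
qed

lemma mixdet_cong:
  assumes "\<And>l i j. l \<le> r \<Longrightarrow> i < g \<Longrightarrow> j < g \<Longrightarrow> X l i j = Y l i j"
  shows "mixdet g r X m = mixdet g r Y m"
  unfolding mixdet_def
proof (intro sum.cong refl arg_cong2[where f = "(*)"] prod.cong)
  fix p \<phi> i
  assume "p \<in> {p. p permutes {0..<g}}" "i \<in> {0..<g}"
    "\<phi> \<in> {\<phi> \<in> {0..<g} \<rightarrow>\<^sub>E {..r}. (\<Sum>i = 0..<g. Poly_Mapping.single (\<phi> i) 1) = m}"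
  then show "X (\<phi> i) i (p i) = Y (\<phi> i) i (p i)"
    using permutes_in_image[of p "{0..<g}" i] by (intro assms) auto
qed

lemma (in comm_ring_hom) hom_mixdet:
  "hom (mixdet g r X m) = mixdet g r (\<lambda>l i j. hom (X l i j)) m"
proof -
  have "hom (signof p * x) = signof p * hom x" for p :: "nat \<Rightarrow> nat" and x
    by (auto simp: sign_def hom_distribs)
  then show ?thesis by (simp add: mixdet_def hom_distribs)
qed

lemma Theta_eq_mixdet:
  "Theta g r m = mixdet g r (\<lambda>l i j. Var (TVar l (min i j) (max i j)) :: (tvar, 'k::field) mpoly) m"
proof -
  have "Theta g r m = mixdet g r (\<lambda>l i j. T_mat g l $$ (i, j) :: (tvar, 'k) mpoly) m"
    unfolding Theta_def yT_mat_def by (rule lookup_det_linear_combination)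
  also have "\<dots> = mixdet g r (\<lambda>l i j. Var (TVar l (min i j) (max i j))) m"
    by (rule mixdet_cong) (simp add: T_mat_def)
  finally show ?thesis .
qed

lemma eval_Theta:
  assumes "comm_ring_hom (\<phi> :: 'k::field \<Rightarrow> 'b::comm_ring_1)"
  shows "eval_mpoly \<phi> x (Theta g r m) = mixdet g r (\<lambda>l i j. x (TVar l (min i j) (max i j))) m"
proof -
  interpret \<phi>: comm_ring_hom \<phi> by fact
  interpret E: comm_ring_hom "eval_mpoly \<phi> x" by (rule \<phi>.comm_ring_hom_eval_mpoly)
  show ?thesis by (simp add: Theta_eq_mixdet E.hom_mixdet)
qed

lemma Theta_in_T_ring: "Theta g r m \<in> T_ring g r"
  unfolding T_ring_def Theta_eq_mixdet mixdet_def
proof (rule CollectI, intro vars_sum)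
  fix p \<phi>
  assume p: "p \<in> {p. p permutes {0..<g}}" and
    \<phi>: "\<phi> \<in> {\<phi> \<in> {0..<g} \<rightarrow>\<^sub>E {..r}. (\<Sum>i = 0..<g. Poly_Mapping.single (\<phi> i) 1) = m}"
  have "vars (\<Prod>i = 0..<g. Var (TVar (\<phi> i) (min i (p i)) (max i (p i))) :: (tvar, 'a) mpoly) \<subseteq> tvars g r"
  proof (rule vars_prod)
    fix i assume "i \<in> {0..<g}"
    then have "p i < g" "i < g" "\<phi> i \<le> r"
      using p \<phi> permutes_in_image[of p "{0..<g}" i] by auto
    then show "vars (Var (TVar (\<phi> i) (min i (p i)) (max i (p i))) :: (tvar, 'a) mpoly) \<subseteq> tvars g r"
      by (auto simp: tvars_def min_def max_def)
  qed
  then show "vars (signof p * (\<Prod>i = 0..<g. Var (TVar (\<phi> i) (min i (p i)) (max i (p i)))) :: (tvar, 'a) mpoly)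
      \<subseteq> tvars g r"
    by (auto simp: sign_def)
qed

section \<open>Congruence of tuples of symmetric matrices\<close>

lemma index_congruence_mat:
  fixes A B :: "'a::comm_ring_1 mat"
  assumes "A \<in> carrier_mat g g" "B \<in> carrier_mat g g" "i < g" "j < g"
  shows "(A * B * transpose_mat A) $$ (i, j) =
    (\<Sum>a = 0..<g. \<Sum>b = 0..<g. A $$ (i, a) * B $$ (a, b) * A $$ (j, b))"
  using assms by (auto simp: scalar_prod_def sum_distrib_left mult.assoc intro!: sum.cong)

lemma index_congruence_mat_commute:
  fixes A B :: "'a::comm_ring_1 mat"
  assumes "A \<in> carrier_mat g g" "B \<in> carrier_mat g g" "i < g" "j < g"
    and sym: "\<And>a b. a < g \<Longrightarrow> b < g \<Longrightarrow> B $$ (a, b) = B $$ (b, a)"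
  shows "(A * B * transpose_mat A) $$ (i, j) = (A * B * transpose_mat A) $$ (j, i)"
proof -
  have "(\<Sum>a = 0..<g. \<Sum>b = 0..<g. A $$ (i, a) * B $$ (a, b) * A $$ (j, b))
      = (\<Sum>b = 0..<g. \<Sum>a = 0..<g. A $$ (j, b) * B $$ (b, a) * A $$ (i, a))"
    by (subst sum.swap) (auto simp: sym mult_ac intro!: sum.cong)
  then show ?thesis
    unfolding index_congruence_mat[OF assms(1-4)] index_congruence_mat[OF assms(1,2,4,3)] .
qed

text \<open>Variables exist only for i \<le> j, so substituting into \<open>Theta\<close> produces
  the entries at (min i j, max i j). Symmetry turns these into the entries at (i, j), to which
  \<open>mixdet_congruence\<close> applies.\<close>

lemma index_congruence_mat_min_max:
  fixes A B :: "'a::comm_ring_1 mat"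
  assumes "A \<in> carrier_mat g g" "B \<in> carrier_mat g g" "i < g" "j < g"
    and "\<And>a b. a < g \<Longrightarrow> b < g \<Longrightarrow> B $$ (a, b) = B $$ (b, a)"
  shows "(A * B * transpose_mat A) $$ (min i j, max i j) = (A * B * transpose_mat A) $$ (i, j)"
  using index_congruence_mat_commute[OF assms] by (auto simp: min_def max_def)

text \<open>Congruence by \<open>N\<close> commutes with forming the linear combination
  \<open>Y\<close> of the matrices with indeterminate coefficients y_l. It multiplies the
  determinant of \<open>Y\<close> by (det N)^2 = 1, and comparing coefficients of y^m gives the
  claim.\<close>

lemma mixdet_congruence:
  fixes X :: "nat \<Rightarrow> 'a::idom mat"
  assumes N: "N \<in> carrier_mat g g" "det N = 1" and X: "\<And>l. X l \<in> carrier_mat g g"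
  shows "mixdet g r (\<lambda>l i j. (N * X l * transpose_mat N) $$ (i, j)) m = mixdet g r (\<lambda>l i j. X l $$ (i, j)) m"
proof -
  interpret C: comm_ring_hom "Const :: 'a \<Rightarrow> (nat, 'a) mpoly" by (rule comm_ring_hom_Const)
  define M where "M = map_mat (Const :: 'a \<Rightarrow> (nat, 'a) mpoly) N"
  define Y where "Y = mat g g (\<lambda>(i, j). \<Sum>l\<le>r. Var l * Const (X l $$ (i, j)) :: (nat, 'a) mpoly)"
  have M: "M \<in> carrier_mat g g" "det M = 1" and Y: "Y \<in> carrier_mat g g"
    using N by (auto simp: M_def Y_def C.hom_det)
  have "mat g g (\<lambda>(i, j). \<Sum>l\<le>r. Var l * Const ((N * X l * transpose_mat N) $$ (i, j))) = M * Y * transpose_mat M"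
    (is "?L = ?R")
  proof (rule eq_matI)
    fix i j assume "i < dim_row ?R" "j < dim_col ?R"
    then have ij: "i < g" "j < g" using M by auto
    have "?L $$ (i, j) = (\<Sum>l\<le>r. \<Sum>a = 0..<g. \<Sum>b = 0..<g. Var l * Const (N $$ (i, a) * X l $$ (a, b) * N $$ (j, b)))"
      using ij by (simp add: index_congruence_mat[OF N(1) X] hom_distribs sum_distrib_left)
    also have "\<dots> = (\<Sum>a = 0..<g. \<Sum>b = 0..<g. \<Sum>l\<le>r. Var l * Const (N $$ (i, a) * X l $$ (a, b) * N $$ (j, b)))"
      by (subst sum.swap, rule sum.cong[OF refl], rule sum.swap)
    also have "\<dots> = (\<Sum>a = 0..<g. \<Sum>b = 0..<g. M $$ (i, a) * Y $$ (a, b) * M $$ (j, b))"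
      using ij N(1) by (intro sum.cong refl)
        (simp add: M_def Y_def hom_distribs sum_distrib_left sum_distrib_right mult_ac)
    finally show "?L $$ (i, j) = ?R $$ (i, j)"
      using ij by (simp add: index_congruence_mat[OF M(1) Y])
  qed (use M in auto)
  then have "det (mat g g (\<lambda>(i, j). \<Sum>l\<le>r. Var l * Const ((N * X l * transpose_mat N) $$ (i, j)))) = det Y"
    using M Y by (simp add: det_mult[of _ g] det_transpose[of _ g])
  then show ?thesis
    unfolding Y_def by (simp flip: lookup_det_linear_combination)
qed

section \<open>The invariant ring\<close>

text \<open>\<open>SL_act\<close> applies \<open>the\<close> to \<open>mat_inverse\<close>;
  invertibility of matrices of determinant 1 shows that it really receives an inverse there.\<close>

lemma SL_inverse:
  assumes "\<Lambda> \<in> SL g"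
  obtains N where "mat_inverse \<Lambda> = Some N" "N \<in> carrier_mat g g" "det N = 1"
proof -
  have \<Lambda>: "\<Lambda> \<in> carrier_mat g g" "det \<Lambda> = 1" using assms by (auto simp: SL_def)
  then have "\<Lambda> \<in> Units (ring_mat TYPE('a) g ())"
    by (intro det_non_zero_imp_unit) auto
  then obtain N where N: "mat_inverse \<Lambda> = Some N"
    using mat_inverse(1)[OF \<Lambda>(1), where b = "()"] by (cases "mat_inverse \<Lambda>") auto
  from mat_inverse(2)[OF \<Lambda>(1) N] have "\<Lambda> * N = 1\<^sub>m g" "N \<in> carrier_mat g g" by auto
  then have "det N = 1" using det_mult[OF \<Lambda>(1), of N] \<Lambda>(2) by simp
  then show ?thesis using that N \<open>N \<in> carrier_mat g g\<close> by blast
qed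

lemma mat_inverse_eqI:
  assumes "\<Lambda> \<in> carrier_mat g g" "N \<in> carrier_mat g g" "N * \<Lambda> = 1\<^sub>m g" "det \<Lambda> = 1"
  shows "mat_inverse \<Lambda> = Some (N :: 'k::field mat)"
proof -
  obtain N' where N': "mat_inverse \<Lambda> = Some N'"
    using SL_inverse[of \<Lambda> g] assms by (auto simp: SL_def)
  from mat_inverse(2)[OF assms(1) N'] have N'': "\<Lambda> * N' = 1\<^sub>m g" "N' \<in> carrier_mat g g" by auto
  have "N = N * (\<Lambda> * N')" using N'' assms(2) by simp
  also have "\<dots> = N * \<Lambda> * N'" using assms N'' by (intro assoc_mult_mat[symmetric]) auto
  also have "\<dots> = N'" using N'' assms(3) by simp
  finally have "N = N'" .
  then show ?thesis using N' by simp
qed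

lemma comm_ring_hom_SL_act: "comm_ring_hom (SL_act g \<Lambda>)"
proof -
  interpret C: comm_ring_hom "Const :: 'a \<Rightarrow> (tvar, 'a) mpoly" by (rule comm_ring_hom_Const)
  show ?thesis unfolding SL_act_def Let_def by (rule C.comm_ring_hom_eval_mpoly)
qed

lemma SL_act_Const [simp]: "SL_act g \<Lambda> (Const c) = Const c"
proof -
  interpret C: comm_ring_hom "Const :: 'a \<Rightarrow> (tvar, 'a) mpoly" by (rule comm_ring_hom_Const)
  show ?thesis unfolding SL_act_def Let_def by (rule C.eval_mpoly_Const)
qed

lemma T_mat_carrier [simp]: "T_mat g l \<in> carrier_mat g g"
  by (simp add: T_mat_def)

lemma T_mat_commute: "a < g \<Longrightarrow> b < g \<Longrightarrow> T_mat g l $$ (a, b) = T_mat g l $$ (b, a)"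
  by (simp add: T_mat_def min.commute max.commute)

lemma SL_act_Theta:
  assumes "\<Lambda> \<in> SL g"
  shows "SL_act g \<Lambda> (Theta g r m) = (Theta g r m :: (tvar, 'k::field) mpoly)"
proof -
  interpret C: comm_ring_hom "Const :: 'k \<Rightarrow> (tvar, 'k) mpoly" by (rule comm_ring_hom_Const)
  obtain N where N: "mat_inverse \<Lambda> = Some N" "N \<in> carrier_mat g g" "det N = 1"
    using SL_inverse[OF assms] by blast
  define M where "M = map_mat (Const :: 'k \<Rightarrow> (tvar, 'k) mpoly) N"
  have M: "M \<in> carrier_mat g g" "det M = 1"
    using N by (auto simp: M_def C.hom_det)
  have "SL_act g \<Lambda> (Theta g r m) =
      mixdet g r (\<lambda>l i j. (M * T_mat g l * transpose_mat M) $$ (min i j, max i j)) m"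
    unfolding SL_act_def Let_def N(1) option.sel M_def[symmetric]
    by (simp add: eval_Theta[OF comm_ring_hom_Const])
  also have "\<dots> = mixdet g r (\<lambda>l i j. (M * T_mat g l * transpose_mat M) $$ (i, j)) m"
    using M by (intro mixdet_cong index_congruence_mat_min_max) (auto simp: T_mat_commute)
  also have "\<dots> = mixdet g r (\<lambda>l i j. T_mat g l $$ (i, j)) m"
    by (rule mixdet_congruence[OF M]) simp
  also have "\<dots> = Theta g r m"
    unfolding Theta_def yT_mat_def by (rule lookup_det_linear_combination[symmetric])
  finally show ?thesis .
qed

lemma Theta_in_SL_invariants: "Theta g r m \<in> SL_invariants g r"
  by (simp add: SL_invariants_def Theta_in_T_ring SL_act_Theta)

lemma Const_in_SL_invariants: "Const c \<in> SL_invariants g r"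
  by (simp add: SL_invariants_def T_ring_def)

lemma one_in_SL_invariants: "1 \<in> SL_invariants g r"
  using Const_in_SL_invariants[of 1] by (simp add: Const_def)

lemma SL_invariants_add:
  assumes "p \<in> SL_invariants g r" "q \<in> SL_invariants g r"
  shows "p + q \<in> SL_invariants g r"
proof -
  have "SL_act g \<Lambda> (p + q) = p + q" if "\<Lambda> \<in> SL g" for \<Lambda>
  proof -
    interpret A: comm_ring_hom "SL_act g \<Lambda>" by (rule comm_ring_hom_SL_act)
    show ?thesis using assms that by (simp add: A.hom_add SL_invariants_def)
  qed
  moreover have "vars (p + q) \<subseteq> tvars g r"
    using assms vars_add[of p q] by (auto simp: SL_invariants_def T_ring_def)
  ultimately show ?thesis by (simp add: SL_invariants_def T_ring_def)
qed

lemma SL_invariants_mult: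
  assumes "p \<in> SL_invariants g r" "q \<in> SL_invariants g r"
  shows "p * q \<in> SL_invariants g r"
proof -
  have "SL_act g \<Lambda> (p * q) = p * q" if "\<Lambda> \<in> SL g" for \<Lambda>
  proof -
    interpret A: comm_ring_hom "SL_act g \<Lambda>" by (rule comm_ring_hom_SL_act)
    show ?thesis using assms that by (simp add: A.hom_mult SL_invariants_def)
  qed
  moreover have "vars (p * q) \<subseteq> tvars g r"
    using assms vars_mult[of p q] by (auto simp: SL_invariants_def T_ring_def)
  ultimately show ?thesis by (simp add: SL_invariants_def T_ring_def)
qed

lemma SL_invariants_sum:
  "(\<And>i. i \<in> A \<Longrightarrow> f i \<in> SL_invariants g r) \<Longrightarrow> sum f A \<in> SL_invariants g r"
proof (induction A rule: infinite_finite_induct)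
  case (insert x F)
  then show ?case by (simp add: SL_invariants_add)
qed (use Const_in_SL_invariants[of 0] in \<open>simp_all add: Const_def\<close>)

lemma SL_invariants_prod:
  "(\<And>i. i \<in> A \<Longrightarrow> f i \<in> SL_invariants g r) \<Longrightarrow> prod f A \<in> SL_invariants g r"
proof (induction A rule: infinite_finite_induct)
  case (insert x F)
  then show ?case by (simp add: SL_invariants_mult)
qed (simp_all add: one_in_SL_invariants)

lemma SL_invariants_power: "p \<in> SL_invariants g r \<Longrightarrow> p ^ n \<in> SL_invariants g r"
  using SL_invariants_prod[of "{..<n}" "\<lambda>_. p"] by simp

section \<open>Algebraic independence\<close>

lemma prod_monom:
  "finite A \<Longrightarrow> (\<Prod>i\<in>A. monom (c i) (w i)) = monom (\<Prod>i\<in>A. c i :: 'a::comm_ring_1) (\<Sum>i\<in>A. w i)"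
  by (induction rule: finite_induct) (simp_all add: mult_monom)

text \<open>With monomials in t as entries, every pair (\<open>p\<close>, \<open>\<phi>\<close>)
  contributes a monomial in t, so a pair that strictly beats all others alone determines the
  coefficient at \<open>E\<close>. Pairs meeting a zero entry are exempt from the comparison, which
  later disposes of the off-diagonal entries of T^(0) and T^(1).\<close>

lemma mixdet_monom_leading:
  fixes c :: "nat \<Rightarrow> nat \<Rightarrow> nat \<Rightarrow> 'a::idom" and w :: "nat \<Rightarrow> nat \<Rightarrow> nat \<Rightarrow> nat"
  assumes p0: "p0 permutes {0..<g}"
    and \<phi>0: "\<phi>0 \<in> {0..<g} \<rightarrow>\<^sub>E {..r}" "(\<Sum>i = 0..<g. Poly_Mapping.single (\<phi>0 i) 1) = m"
    and max: "\<And>p \<phi>. p permutes {0..<g} \<Longrightarrow> \<phi> \<in> {0..<g} \<rightarrow>\<^sub>E {..r} \<Longrightarrow>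
       (\<Sum>i = 0..<g. Poly_Mapping.single (\<phi> i) 1) = m \<Longrightarrow> (p, \<phi>) \<noteq> (p0, \<phi>0) \<Longrightarrow>
       (\<And>i. i < g \<Longrightarrow> c (\<phi> i) i (p i) \<noteq> 0) \<Longrightarrow>
       (\<Sum>i = 0..<g. w (\<phi> i) i (p i)) < (\<Sum>i = 0..<g. w (\<phi>0 i) i (p0 i))"
  defines "E \<equiv> \<Sum>i = 0..<g. w (\<phi>0 i) i (p0 i)"
    and "D \<equiv> mixdet g r (\<lambda>l i j. monom (c l i j) (w l i j)) m"
  shows "degree D \<le> E" and "poly.coeff D E = signof p0 * (\<Prod>i = 0..<g. c (\<phi>0 i) i (p0 i))"
proof -
  define S where "S = {p. p permutes {0..<g}} \<times>
    {\<phi> \<in> {0..<g} \<rightarrow>\<^sub>E {..r}. (\<Sum>i = 0..<g. Poly_Mapping.single (\<phi> i) (1::nat)) = m}"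
  define C where "C = (\<lambda>(p, \<phi>). signof p * (\<Prod>i = 0..<g. c (\<phi> i) i (p i)))"
  define w' where "w' = (\<lambda>(p, \<phi>). \<Sum>i = 0..<g. w (\<phi> i) i (p i))"
  have "finite ({0..<g} \<rightarrow>\<^sub>E {..r})" by (intro finite_PiE) auto
  then have finS: "finite S"
    unfolding S_def by (intro finite_cartesian_product finite_permutations) auto
  have mem: "(p0, \<phi>0) \<in> S" using p0 \<phi>0 by (simp add: S_def)
  have sgn: "signof p * monom x n = monom (signof p * x :: 'a) n" for p :: "nat \<Rightarrow> nat" and x n
    by (auto simp: sign_def minus_monom)
  have "D = (\<Sum>x\<in>S. monom (C x) (w' x))"
    unfolding D_def mixdet_def S_def C_def w'_def
    by (simp add: sum.cartesian_product prod_monom sgn case_prod_unfold)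
  moreover have lt: "w' x < E" if "x \<in> S" "x \<noteq> (p0, \<phi>0)" "C x \<noteq> 0" for x
  proof -
    obtain p \<phi> where x: "x = (p, \<phi>)" by (cases x)
    have "c (\<phi> i) i (p i) \<noteq> 0" if "i < g" for i
      using \<open>C x \<noteq> 0\<close> that by (auto simp: C_def x)
    then show ?thesis
      using that unfolding x w'_def E_def prod.case S_def by (intro max) auto
  qed
  moreover have w0: "w' (p0, \<phi>0) = E" by (simp add: w'_def E_def)
  ultimately have D: "D = (\<Sum>x\<in>S. monom (C x) (w' x))" by simp
  show "degree D \<le> E"
    unfolding D
  proof (rule degree_sum_le[OF finS])
    fix x assume "x \<in> S"
    then show "degree (monom (C x) (w' x)) \<le> E"
      using lt[of x] w0 degree_monom_le[of "C x" "w' x"]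
      by (cases "C x = 0"; cases "x = (p0, \<phi>0)") force+
  qed
  have "poly.coeff D E = (\<Sum>x\<in>S. if x = (p0, \<phi>0) then C (p0, \<phi>0) else 0)"
    unfolding D coeff_sum
  proof (rule sum.cong[OF refl])
    fix x assume "x \<in> S"
    then show "poly.coeff (monom (C x) (w' x)) E = (if x = (p0, \<phi>0) then C (p0, \<phi>0) else 0)"
      using lt[of x] w0 by (cases "C x = 0"; cases "x = (p0, \<phi>0)") force+
  qed
  also have "\<dots> = C (p0, \<phi>0)" using finS mem by simp
  finally show "poly.coeff D E = signof p0 * (\<Prod>i = 0..<g. c (\<phi>0 i) i (p0 i))"
    by (simp add: C_def)
qed

section \<open>The optimal permutation and row labelling\<close>

definition block_rev :: "nat \<Rightarrow> nat \<Rightarrow> nat \<Rightarrow> nat" where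
  "block_rev a k i = (if a \<le> i \<and> i < a + k then 2 * a + k - 1 - i else i)"

text \<open>The rows labelled l are those reversed by \<open>block_rev a k\<close>, whose entries
  there form the antidiagonal of a principal block. Outside \<open>{0..<g}\<close> the value is
  \<open>undefined\<close>, as the labellings in \<open>mixdet\<close> are extensional.\<close>

definition block_label :: "nat \<Rightarrow> nat \<Rightarrow> nat \<Rightarrow> nat \<Rightarrow> nat \<Rightarrow> nat" where
  "block_label g a k l = (\<lambda>i\<in>{0..<g}. if i < a then 1 else if i < a + k then l else 0)"

lemma block_rev_permutes: "block_rev a k permutes {a..<a + k}"
proof -
  have "block_rev a k (block_rev a k i) = i" for i
    by (auto simp: block_rev_def)
  then have "\<exists>!i. block_rev a k i = j" for j by metis
  then show ?thesis unfolding permutes_def by (auto simp: block_rev_def)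
qed

text \<open>Put s = 2a + k - 1. The sum of (i - p i)^2 + (i + p i - s)^2 over the block is the same
  for all permutations of the block. Hence the squared differences are largest where the second
  squares all vanish, that is for p i = s - i, the reversal of the block.\<close>

lemma sum_sq_diff_less_block_rev:
  assumes p: "p permutes {a..<a + k}" and ne: "p \<noteq> block_rev a k"
  shows "(\<Sum>i = a..<a + k. (max i (p i) - min i (p i))\<^sup>2)
       < (\<Sum>i = a..<a + k. (max i (block_rev a k i) - min i (block_rev a k i))\<^sup>2)"
proof -
  let ?B = "{a..<a + k}"
  define s where "s = int (2 * a + k) - 1"
  define C where "C = (\<Sum>i\<in>?B. 4 * (int i)\<^sup>2 - 4 * s * int i + s\<^sup>2)"
  have sq: "int ((max i j - min i j)\<^sup>2) = (int i - int j)\<^sup>2" for i j :: nat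
    by (auto simp: max_def min_def of_nat_diff power2_commute)
  have id: "(\<Sum>i\<in>?B. (int i - int (q i))\<^sup>2) = C - (\<Sum>i\<in>?B. (int i + int (q i) - s)\<^sup>2)"
    if q: "q permutes ?B" for q
  proof -
    have "(\<Sum>i\<in>?B. (int i - int (q i))\<^sup>2) + (\<Sum>i\<in>?B. (int i + int (q i) - s)\<^sup>2)
        = (\<Sum>i\<in>?B. 2 * (int i)\<^sup>2 - 2 * s * int i + s\<^sup>2) + (\<Sum>i\<in>?B. 2 * (int (q i))\<^sup>2 - 2 * s * int (q i))"
      unfolding sum.distrib[symmetric]
      by (intro sum.cong refl) (simp add: power2_eq_square algebra_simps)
    also have "(\<Sum>i\<in>?B. 2 * (int (q i))\<^sup>2 - 2 * s * int (q i)) = (\<Sum>i\<in>?B. 2 * (int i)\<^sup>2 - 2 * s * int i)"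
      using sum.permute[OF q, of "\<lambda>i. 2 * (int i)\<^sup>2 - 2 * s * int i"] by (simp add: o_def)
    also have "(\<Sum>i\<in>?B. 2 * (int i)\<^sup>2 - 2 * s * int i + s\<^sup>2) + \<dots> = C"
      unfolding C_def sum.distrib[symmetric] by (intro sum.cong refl) simp
    finally show ?thesis by linarith
  qed
  have rev0: "(\<Sum>i\<in>?B. (int i + int (block_rev a k i) - s)\<^sup>2) = 0"
    by (intro sum.neutral) (auto simp: block_rev_def s_def of_nat_diff)
  obtain i where i: "p i \<noteq> block_rev a k i" using ne by (auto simp: fun_eq_iff)
  then have iB: "i \<in> ?B"
    using permutes_not_in[OF p, of i] by (auto simp: block_rev_def split: if_splits)
  have "int i + int (p i) - s \<noteq> 0"
    using i iB by (auto simp: block_rev_def s_def)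
  then have "(\<Sum>i\<in>?B. (int i + int (p i) - s)\<^sup>2) > 0"
    using iB by (intro sum_pos2[of _ i]) auto
  then have "(\<Sum>i\<in>?B. (int i - int (p i))\<^sup>2) < (\<Sum>i\<in>?B. (int i - int (block_rev a k i))\<^sup>2)"
    using id[OF p] id[OF block_rev_permutes] rev0 by simp
  then have "int (\<Sum>i\<in>?B. (max i (p i) - min i (p i))\<^sup>2)
      < int (\<Sum>i\<in>?B. (max i (block_rev a k i) - min i (block_rev a k i))\<^sup>2)"
    unfolding of_nat_sum sq .
  then show ?thesis by (simp only: of_nat_less_iff)
qed

text \<open>The factor \<open>g\<^sup>3 + 1\<close> exceeds every sum of \<open>g\<close> squares of differences of row and column indices.\<close>

definition curve_wt :: "nat \<Rightarrow> nat \<Rightarrow> nat \<Rightarrow> nat \<Rightarrow> nat" where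
  "curve_wt g l i j =
     (if l = 0 then (g ^ 3 + 1) * i else if l = 1 then (g ^ 3 + 1) * (g - 1 - i) else (j - i)\<^sup>2)"

lemma lookup_sum_single_card:
  "finite A \<Longrightarrow> Poly_Mapping.lookup (\<Sum>i\<in>A. Poly_Mapping.single (\<phi> i) (1::nat)) l = card {i \<in> A. \<phi> i = l}"
  by (simp add: lookup_sum lookup_single when_def sum.If_cases Int_def)

lemma block_label_type:
  assumes "a + k + b = g" "l \<ge> 2"
  shows "(\<Sum>i = 0..<g. Poly_Mapping.single (block_label g a k l i) 1)
       = Poly_Mapping.single 0 b + Poly_Mapping.single 1 a + Poly_Mapping.single l k"
proof (rule poly_mapping_eqI)
  fix x
  have label: "{i \<in> {0..<g}. block_label g a k l i = x} =
    (if x = 0 then {a + k..<g} else if x = 1 then {0..<a} else if x = l then {a..<a + k} else {})"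
    using assms by (auto simp: block_label_def split: if_splits)
  have "card {i \<in> {0..<g}. block_label g a k l i = x} =
      (if x = 0 then b else if x = 1 then a else if x = l then k else 0)"
    unfolding label using assms by auto
  then show "Poly_Mapping.lookup (\<Sum>i = 0..<g. Poly_Mapping.single (block_label g a k l i) 1) x
     = Poly_Mapping.lookup (Poly_Mapping.single 0 b + Poly_Mapping.single 1 a + Poly_Mapping.single l k) x"
    unfolding lookup_sum_single_card[OF finite_atLeastLessThan]
    using assms by (simp only:) (simp add: lookup_add lookup_single when_def)
qed

text \<open>
  Subtracting suitable constants from the weights of the labels \<open>0\<close> and \<open>1\<close> does not
  change comparisons between labellings of the same type, and makes \<open>block_label\<close> optimal
  row by row.
\<close>

lemma label_weight_less:
  fixes v :: "nat \<Rightarrow> nat \<Rightarrow> nat"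
  assumes abk: "a + k + b = g" "l \<ge> 2"
    and \<phi>: "\<phi> \<in> {0..<g} \<rightarrow>\<^sub>E UNIV"
      "(\<Sum>i = 0..<g. Poly_Mapping.single (\<phi> i) 1)
         = Poly_Mapping.single 0 b + Poly_Mapping.single 1 a + Poly_Mapping.single l k"
    and ne: "\<phi> \<noteq> block_label g a k l"
  defines "v \<equiv> \<lambda>x i. if x = 0 then i else if x = 1 then g - 1 - i else 0"
  shows "(\<Sum>i = 0..<g. v (\<phi> i) i) < (\<Sum>i = 0..<g. v (block_label g a k l i) i)"
proof -
  let ?\<beta> = "block_label g a k l"
  \<comment> \<open>\<open>u\<close> is twice \<open>v\<close>, shifted by \<open>A\<close> for
    label 0 and by \<open>B\<close> for label 1. The shifted weight of label 0 is positive exactly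
    for i \<ge> a + k, that of label 1 exactly for i < a, and label l has 0; doubling makes the
    first two odd, so no row has a tie.\<close>
  define u :: "nat \<Rightarrow> nat \<Rightarrow> int" where
    "u x i = (if x = 0 then 2 * int i - 2 * int (a + k) + 1 else if x = 1 then 2 * int a - 1 - 2 * int i else 0)" for x i
  define A where "A = 1 - 2 * int (a + k)"
  define B where "B = 2 * int a - 1 - 2 * (int g - 1)"
  have sum_u: "(\<Sum>i = 0..<g. u (\<psi> i) i) = 2 * int (\<Sum>i = 0..<g. v (\<psi> i) i) + A * int b + B * int a"
    if "(\<Sum>i = 0..<g. Poly_Mapping.single (\<psi> i) 1)
         = Poly_Mapping.single 0 b + Poly_Mapping.single 1 a + Poly_Mapping.single l k" for \<psi>
  proof -
    have card: "card {i \<in> {0..<g}. \<psi> i = x} =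
        Poly_Mapping.lookup (Poly_Mapping.single 0 b + Poly_Mapping.single 1 a + Poly_Mapping.single l k) x" for x
      unfolding that[symmetric] by (rule lookup_sum_single_card[symmetric]) simp
    have c0: "card {i \<in> {0..<g}. \<psi> i = 0} = b" and c1: "card {i \<in> {0..<g}. \<psi> i = 1} = a"
      using abk by (simp_all only: card) (simp_all add: lookup_add lookup_single when_def)
    have "(\<Sum>i = 0..<g. u (\<psi> i) i) = (\<Sum>i = 0..<g. 2 * int (v (\<psi> i) i)
        + (if \<psi> i = 0 then A else 0) + (if \<psi> i = 1 then B else 0))"
      by (intro sum.cong refl) (auto simp: u_def v_def A_def B_def of_nat_diff)
    also have "\<dots> = 2 * int (\<Sum>i = 0..<g. v (\<psi> i) i) + A * int b + B * int a"
      using c0 c1 by (simp add: sum.distrib sum_distrib_left sum.inter_filter[symmetric])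
    finally show ?thesis .
  qed
  have lab: "\<phi> i \<in> {0, 1, l}" if "i < g" for i
  proof (rule ccontr)
    assume "\<phi> i \<notin> {0, 1, l}"
    then have "card {j \<in> {0..<g}. \<phi> j = \<phi> i} = 0"
      using \<phi>(2) by (subst lookup_sum_single_card[symmetric])
        (simp_all add: lookup_add lookup_single when_def)
    then show False using that by auto
  qed
  have le: "u (\<phi> i) i \<le> u (?\<beta> i) i" and eq: "\<phi> i \<noteq> ?\<beta> i \<Longrightarrow> u (\<phi> i) i < u (?\<beta> i) i" if "i < g" for i
    using lab[OF that] that abk by (auto simp: u_def block_label_def)
  obtain i where i: "\<phi> i \<noteq> ?\<beta> i" using ne by blast
  have "i < g"
  proof (rule ccontr)
    assume "\<not> i < g"
    then have "\<phi> i = undefined" "?\<beta> i = undefined"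
      using PiE_arb[OF \<phi>(1), of i] by (simp_all add: block_label_def)
    then show False using i by simp
  qed
  then have "(\<Sum>i = 0..<g. u (\<phi> i) i) < (\<Sum>i = 0..<g. u (?\<beta> i) i)"
    using le eq[of i] i by (intro sum_strict_mono_ex1) auto
  then show ?thesis
    unfolding sum_u[OF \<phi>(2)] sum_u[OF block_label_type[OF abk]] by linarith
qed

text \<open>The comparison is lexicographic. The total weight is g^3 + 1 times the label weight plus
  a sum of squares of at most g * g^2, so a different labelling already loses by its label weight.
  For equal labellings, \<open>diag\<close> makes \<open>p\<close> fix all rows outside the block,
  and \<open>sum_sq_diff_less_block_rev\<close> decides.\<close>

lemma curve_wt_less:
  assumes abk: "a + k + b = g" "l \<ge> 2"
    and p: "p permutes {0..<g}"
    and \<phi>: "\<phi> \<in> {0..<g} \<rightarrow>\<^sub>E UNIV"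
      "(\<Sum>i = 0..<g. Poly_Mapping.single (\<phi> i) 1)
         = Poly_Mapping.single 0 b + Poly_Mapping.single 1 a + Poly_Mapping.single l k"
    and diag: "\<And>i. i < g \<Longrightarrow> \<phi> i < 2 \<Longrightarrow> p i = i"
    and ne: "(p, \<phi>) \<noteq> (block_rev a k, block_label g a k l)"
  shows "(\<Sum>i = 0..<g. curve_wt g (\<phi> i) (min i (p i)) (max i (p i)))
       < (\<Sum>i = 0..<g. curve_wt g (block_label g a k l i) (min i (block_rev a k i)) (max i (block_rev a k i)))"
proof -
  let ?\<beta> = "block_label g a k l" and ?R = "block_rev a k"
  define v :: "nat \<Rightarrow> nat \<Rightarrow> nat" where
    "v x i = (if x = 0 then i else if x = 1 then g - 1 - i else 0)" for x i
  define q where "q x i j = (if x < 2 then 0 else (max i j - min i j)\<^sup>2)" for x i j :: nat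
  have split: "(\<Sum>i = 0..<g. curve_wt g (\<psi> i) (min i (s i)) (max i (s i)))
      = (g ^ 3 + 1) * (\<Sum>i = 0..<g. v (\<psi> i) i) + (\<Sum>i = 0..<g. q (\<psi> i) i (s i))"
    if "\<And>i. i < g \<Longrightarrow> \<psi> i < 2 \<Longrightarrow> s i = i" for \<psi> s :: "nat \<Rightarrow> nat"
  proof -
    have "(\<Sum>i = 0..<g. curve_wt g (\<psi> i) (min i (s i)) (max i (s i)))
      = (\<Sum>i = 0..<g. (g ^ 3 + 1) * v (\<psi> i) i + q (\<psi> i) i (s i))"
    proof (rule sum.cong[OF refl])
      fix i assume "i \<in> {0..<g}"
      then show "curve_wt g (\<psi> i) (min i (s i)) (max i (s i)) = (g ^ 3 + 1) * v (\<psi> i) i + q (\<psi> i) i (s i)"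
        using that[of i] by (auto simp: curve_wt_def v_def q_def)
    qed
    then show ?thesis by (simp only: sum.distrib sum_distrib_left)
  qed
  have diag': "?R i = i" if "i < g" "?\<beta> i < 2" for i
    using that abk by (auto simp: block_label_def block_rev_def split: if_splits)
  have split_p: "(\<Sum>i = 0..<g. curve_wt g (\<phi> i) (min i (p i)) (max i (p i)))
      = (g ^ 3 + 1) * (\<Sum>i = 0..<g. v (\<phi> i) i) + (\<Sum>i = 0..<g. q (\<phi> i) i (p i))"
    by (rule split) (rule diag)
  have split_R: "(\<Sum>i = 0..<g. curve_wt g (?\<beta> i) (min i (?R i)) (max i (?R i)))
      = (g ^ 3 + 1) * (\<Sum>i = 0..<g. v (?\<beta> i) i) + (\<Sum>i = 0..<g. q (?\<beta> i) i (?R i))"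
    by (rule split) (rule diag')
  show ?thesis
  proof (cases "\<phi> = ?\<beta>")
    case False
    then have "(\<Sum>i = 0..<g. v (\<phi> i) i) + 1 \<le> (\<Sum>i = 0..<g. v (?\<beta> i) i)"
      using label_weight_less[OF abk \<phi> False] by (simp add: v_def)
    then have "(g ^ 3 + 1) * ((\<Sum>i = 0..<g. v (\<phi> i) i) + 1) \<le> (g ^ 3 + 1) * (\<Sum>i = 0..<g. v (?\<beta> i) i)"
      by (rule mult_le_mono2)
    moreover have "(\<Sum>i = 0..<g. q (\<phi> i) i (p i)) \<le> (\<Sum>i = 0..<g. g\<^sup>2)"
    proof (rule sum_mono)
      fix i assume "i \<in> {0..<g}"
      then have "max i (p i) \<le> g" using permutes_in_image[OF p, of i] by auto
      then have "(max i (p i) - min i (p i))\<^sup>2 \<le> g\<^sup>2" by (intro power_mono) auto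
      then show "q (\<phi> i) i (p i) \<le> g\<^sup>2" by (auto simp: q_def)
    qed
    ultimately show ?thesis
      unfolding split_p split_R by (simp add: power2_eq_square power3_eq_cube)
  next
    case True
    have pB: "p permutes {a..<a + k}"
    proof (rule permutes_superset[OF p])
      fix i assume "i \<in> {0..<g} - {a..<a + k}"
      then show "p i = i" using diag[of i] by (auto simp: True block_label_def)
    qed
    have "p \<noteq> ?R" using ne True by simp
    have qs: "(\<Sum>i = 0..<g. q (?\<beta> i) i (s i)) = (\<Sum>i = a..<a + k. (max i (s i) - min i (s i))\<^sup>2)"
      for s :: "nat \<Rightarrow> nat"
      using abk by (intro sum.mono_neutral_cong_right) (auto simp: q_def block_label_def)
    show ?thesis
      unfolding split_p split_R
      unfolding True qs using sum_sq_diff_less_block_rev[OF pB \<open>p \<noteq> ?R\<close>] by simp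
  qed
qed

text \<open>The antidiagonal of a block consists of that of the inner block, with first and last row
  removed, and of two corners that carry the same entry by symmetry. Working outwards, the common
  corner entry is a square root of a quotient of prescribed values; such roots exist in every
  characteristic.\<close>

lemma ex_antidiagonal_products:
  fixes v :: "nat \<Rightarrow> nat \<Rightarrow> 'k::alg_closed_field"
  assumes nz: "\<And>a k. v a k \<noteq> 0" and v0: "\<And>a. v a 0 = 1"
  shows "\<exists>s. \<forall>a k. (\<Prod>i = a..<a + k. s (min i (block_rev a k i)) (max i (block_rev a k i))) = v a k"
proof -
  have "\<exists>y. y ^ 2 = x" for x :: 'k
    using nth_root_exists[of 2 x] by auto
  then obtain sq :: "'k \<Rightarrow> 'k" where sq: "\<And>x. sq x ^ 2 = x" by metis
  \<comment> \<open>The entry (i, j) with i < j is the corner of the block of length j - i + 1 at i;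
    its inner block starts at i + 1 and has length j - i - 1. For j = i + 1 the inner block is empty
    and \<open>v0\<close> supplies the value 1.\<close>
  define s where "s i j = (if i = j then v i 1 else sq (v i (j - i + 1) / v (i + 1) (j - i - 1)))" for i j
  have "(\<Prod>i = a..<a + k. s (min i (block_rev a k i)) (max i (block_rev a k i))) = v a k" for a k
  proof (induction k arbitrary: a rule: less_induct)
    case (less k)
    consider "k = 0" | "k = 1" | n where "k = n + 2"
      by (metis One_nat_def add_2_eq_Suc' not0_implies_Suc)
    then show ?case
    proof cases
      case 1
      then show ?thesis by (simp add: v0)
    next
      case 2
      then show ?thesis by (simp add: block_rev_def s_def)
    next
      case (3 n)
      let ?f = "\<lambda>i. s (min i (block_rev a k i)) (max i (block_rev a k i))"
      have "{a..<a + k} = insert a (insert (a + n + 1) {Suc a..<Suc a + n})"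
        using 3 by auto
      then have "(\<Prod>i = a..<a + k. ?f i) = ?f a * (?f (a + n + 1) * (\<Prod>i = Suc a..<Suc a + n. ?f i))"
        by simp
      also have "(\<Prod>i = Suc a..<Suc a + n. ?f i)
          = (\<Prod>i = Suc a..<Suc a + n. s (min i (block_rev (Suc a) n i)) (max i (block_rev (Suc a) n i)))"
      proof (rule prod.cong[OF refl])
        fix i assume "i \<in> {Suc a..<Suc a + n}"
        then have "block_rev a k i = block_rev (Suc a) n i"
          using 3 by (auto simp: block_rev_def)
        then show "?f i = s (min i (block_rev (Suc a) n i)) (max i (block_rev (Suc a) n i))" by simp
      qed
      also have "\<dots> = v (Suc a) n" using 3 by (intro less.IH) simp
      also have "?f a = sq (v a k / v (Suc a) n)"
        using 3 by (simp add: block_rev_def s_def)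
      also have "?f (a + n + 1) = sq (v a k / v (Suc a) n)"
        using 3 by (simp add: block_rev_def s_def)
      also have "sq (v a k / v (Suc a) n) * (sq (v a k / v (Suc a) n) * v (Suc a) n)
          = sq (v a k / v (Suc a) n) ^ 2 * v (Suc a) n"
        by (simp add: power2_eq_square)
      also have "\<dots> = v a k" using nz by (simp add: sq)
      finally show ?thesis .
    qed
  qed
  then show ?thesis by blast
qed

lemma Delta3_cases:
  assumes "m \<in> Delta3 g r" "r \<ge> 2"
  obtains a k b l where "a + k + b = g" "2 \<le> l" "l \<le> r"
    "m = Poly_Mapping.single 0 b + Poly_Mapping.single 1 a + Poly_Mapping.single l k"
proof -
  have m: "Poly_Mapping.keys m \<subseteq> {..r}" "(\<Sum>i\<le>r. Poly_Mapping.lookup m i) = g"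
    using assms by (auto simp: Delta3_def Delta_def)
  obtain l where l: "2 \<le> l" "l \<le> r" "\<And>l'. 2 \<le> l' \<Longrightarrow> l' \<noteq> l \<Longrightarrow> Poly_Mapping.lookup m l' = 0"
  proof (cases "\<exists>l\<in>{2..r}. Poly_Mapping.lookup m l \<noteq> 0")
    case True
    then obtain l where l: "l \<in> {2..r}" "Poly_Mapping.lookup m l \<noteq> 0" by blast
    show ?thesis
    proof (rule that[of l])
      fix l' assume l': "2 \<le> l'" "l' \<noteq> l"
      show "Poly_Mapping.lookup m l' = 0"
      proof (rule ccontr)
        assume nz: "Poly_Mapping.lookup m l' \<noteq> 0"
        then have "l' \<in> {2..r}" using l' m(1) by (auto simp: in_keys_iff subset_iff)
        then show False using assms(1) l l' nz by (auto simp: Delta3_def)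
      qed
    qed (use l in auto)
  next
    case False
    show ?thesis
    \<comment> \<open>Without any nonzero exponent at an index \<ge> 2, the label 2 is taken with an
      empty block; it is available because r \<ge> 2.\<close>
    proof (rule that[of 2])
      fix l' :: nat assume "2 \<le> l'"
      then show "Poly_Mapping.lookup m l' = 0"
        using False m(1) in_keys_iff[of l' m] by (cases "l' \<le> r") auto
    qed (use assms in auto)
  qed
  have eq: "m = Poly_Mapping.single 0 (Poly_Mapping.lookup m 0) + Poly_Mapping.single 1 (Poly_Mapping.lookup m 1)
      + Poly_Mapping.single l (Poly_Mapping.lookup m l)"
  proof (rule poly_mapping_eqI)
    fix x
    show "Poly_Mapping.lookup m x = Poly_Mapping.lookup (Poly_Mapping.single 0 (Poly_Mapping.lookup m 0) +
      Poly_Mapping.single 1 (Poly_Mapping.lookup m 1) + Poly_Mapping.single l (Poly_Mapping.lookup m l)) x"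
      using l(1) l(3)[of x]
      by (cases "x = 0"; cases "x = 1"; cases "x = l") (auto simp: lookup_add lookup_single when_def)
  qed
  have "g = (\<Sum>i\<in>{0, 1, l}. Poly_Mapping.lookup m i)"
    unfolding m(2)[symmetric]
  proof (rule sum.mono_neutral_right)
    show "\<forall>i\<in>{..r} - {0, 1, l}. Poly_Mapping.lookup m i = 0"
      using l(3) by auto
  qed (use l assms in auto)
  then have "Poly_Mapping.lookup m 1 + Poly_Mapping.lookup m l + Poly_Mapping.lookup m 0 = g"
    using l(1) by simp
  then show ?thesis using that l eq by blast
qed

text \<open>\<open>P\<close> vanishes when the variables are replaced by the values of the
  \<open>Theta g r m\<close> at any symmetric matrices over K[t]. Matrices with monomial entries of
  degree \<open>curve_wt\<close> produce curves with arbitrary nonzero leading coefficients, as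
  \<open>mpoly_eq_0_if_0_on_curves\<close> demands.\<close>

lemma Theta_family_independent:
  fixes P :: "(nat \<Rightarrow>\<^sub>0 nat, 'k::alg_closed_field) mpoly"
  assumes g: "g \<ge> 1" and r: "r \<ge> 2" and vars: "vars P \<subseteq> Delta3 g r"
    and zero: "eval_mpoly Const (Theta g r) P = 0"
  shows "P = 0"
proof -
  \<comment> \<open>For k = 0 the exponent vector does not determine l, so one representation is
    fixed for each m.\<close>
  define par where "par m = (SOME (a, k, b, l). a + k + b = g \<and> 2 \<le> l \<and> l \<le> r \<and>
    m = Poly_Mapping.single 0 b + Poly_Mapping.single 1 a + Poly_Mapping.single l k)" for m :: "nat \<Rightarrow>\<^sub>0 nat"
  have par: "\<exists>a k b l. par m = (a, k, b, l) \<and> a + k + b = g \<and> 2 \<le> l \<and> l \<le> r \<and>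
    m = Poly_Mapping.single 0 b + Poly_Mapping.single 1 a + Poly_Mapping.single l k"
    if m: "m \<in> Delta3 g r" for m
  proof -
    have "\<exists>x. case x of (a, k, b, l) \<Rightarrow> a + k + b = g \<and> 2 \<le> l \<and> l \<le> r \<and>
      m = Poly_Mapping.single 0 b + Poly_Mapping.single 1 a + Poly_Mapping.single l k"
      by (rule Delta3_cases[OF m r]) fastforce
    from someI_ex[OF this] show ?thesis
      unfolding par_def[symmetric] by (cases "par m") auto
  qed
  define e where "e m = (case par m of (a, k, b, l) \<Rightarrow>
    \<Sum>i = 0..<g. curve_wt g (block_label g a k l i) (min i (block_rev a k i)) (max i (block_rev a k i)))" for m
  show ?thesis
  proof (rule mpoly_eq_0_if_0_on_curves[where e = e])
    fix \<tau> :: "(nat \<Rightarrow>\<^sub>0 nat) \<Rightarrow> 'k"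
    assume \<tau>: "\<And>m. \<tau> m \<noteq> 0"
    define t where "t j = \<tau> (Poly_Mapping.single 0 (g - j) + Poly_Mapping.single 1 j)" for j
    \<comment> \<open>For k = 0 the leading term is the product of \<beta>_i for i < j and of
      \<alpha>_i for i \<ge> j, and it has to equal \<open>t j\<close>. Only j = 0 involves
      \<alpha>_0, so \<alpha>_0 = \<open>t 0\<close> with all other \<alpha>_i = 1, while the
      \<beta>_i telescope from \<open>t 1\<close> on.\<close>
    define \<alpha> where "\<alpha> i = (if i = 0 then t 0 else 1)" for i :: nat
    define \<beta> where "\<beta> i = (if i = 0 then t 1 else t (Suc i) / t i)" for i
    have t_nz: "t j \<noteq> 0" for j using \<tau> by (simp add: t_def)
    have \<alpha>_nz: "\<alpha> i \<noteq> 0" and \<beta>_nz: "\<beta> i \<noteq> 0" for i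
      using t_nz by (auto simp: \<alpha>_def \<beta>_def)
    have prod_\<beta>: "(\<Prod>i = 0..<Suc j. \<beta> i) = t (Suc j)" for j
    proof (induction j)
      case 0
      then show ?case by (simp add: \<beta>_def)
    next
      case (Suc j)
      then have "(\<Prod>i = 0..<Suc (Suc j). \<beta> i) = t (Suc j) * \<beta> (Suc j)" by simp
      then show ?case using t_nz[of "Suc j"] by (simp add: \<beta>_def)
    qed
    define out where "out a k = (\<Prod>i = 0..<a. \<beta> i) * (\<Prod>i = a + k..<g. \<alpha> i)" for a k
    have out_nz: "out a k \<noteq> 0" for a k
      using \<alpha>_nz \<beta>_nz by (simp add: out_def)
    have out_0: "out a 0 = t a" if "a \<le> g" for a
    proof (cases a)
      case 0
      show ?thesis
      proof -
        have "(\<Prod>i = 0..<g. \<alpha> i) = \<alpha> 0 * (\<Prod>i = Suc 0..<g. \<alpha> i)"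
          using g by (intro prod.atLeast_Suc_lessThan) simp
        also have "(\<Prod>i = Suc 0..<g. \<alpha> i) = 1" by (intro prod.neutral) (auto simp: \<alpha>_def)
        finally show ?thesis using 0 by (simp add: out_def \<alpha>_def)
      qed
    next
      case (Suc n)
      have "(\<Prod>i = a..<g. \<alpha> i) = 1" using Suc by (intro prod.neutral) (auto simp: \<alpha>_def)
      then show ?thesis using Suc prod_\<beta>[of n] by (simp add: out_def)
    qed
    \<comment> \<open>The antidiagonal product still required from T^(l), once the sign and the
      factors of the rows outside the block are divided out. An empty block must give 1, since its
      target is already met by \<open>out_0\<close>. Blocks reaching beyond row g also receive a
      nonzero value, because \<open>ex_antidiagonal_products\<close> treats all a and k.\<close>
    define v where "v l a k = (if k = 0 then 1 else
      \<tau> (Poly_Mapping.single 0 (g - (a + k)) + Poly_Mapping.single 1 a + Poly_Mapping.single l k)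
        / (signof (block_rev a k) * out a k))" for l a k
    have sgn_nz: "(signof p :: 'k) \<noteq> 0" for p :: "nat \<Rightarrow> nat"
      by (auto simp: sign_def)
    have "\<exists>s. \<forall>a k. (\<Prod>i = a..<a + k. s (min i (block_rev a k i)) (max i (block_rev a k i))) = v l a k" for l
      by (rule ex_antidiagonal_products) (use \<tau> sgn_nz out_nz in \<open>auto simp: v_def\<close>)
    then obtain s where s: "\<And>l a k. (\<Prod>i = a..<a + k. s l (min i (block_rev a k i)) (max i (block_rev a k i))) = v l a k"
      by metis
    define c where "c l i j = (if l = 0 then if i = j then \<alpha> i else 0 else
      if l = 1 then if i = j then \<beta> i else 0 else s l i j)" for l i j
    define x where "x = (\<lambda>TVar l i j \<Rightarrow> monom (c l i j) (curve_wt g l i j))"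
    define \<gamma> where "\<gamma> m = eval_mpoly (\<lambda>c. [:c:]) x (Theta g r m)" for m
    have "degree (\<gamma> m) \<le> e m \<and> poly.coeff (\<gamma> m) (e m) = \<tau> m" if m: "m \<in> vars P" for m
    proof -
      from m vars have "m \<in> Delta3 g r" by blast
      from par[OF this] obtain a k b l where
        pm: "par m = (a, k, b, l)" and abk: "a + k + b = g" "2 \<le> l" and l: "l \<le> r" and
        m_eq: "m = Poly_Mapping.single 0 b + Poly_Mapping.single 1 a + Poly_Mapping.single l k"
        by blast
      let ?R = "block_rev a k" and ?L = "block_label g a k l"
      have \<gamma>m: "\<gamma> m = mixdet g r (\<lambda>l i j. monom (c l (min i j) (max i j)) (curve_wt g l (min i j) (max i j))) m"
        by (simp add: \<gamma>_def eval_Theta[OF comm_ring_hom_pCons] x_def)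
      have em: "e m = (\<Sum>i = 0..<g. curve_wt g (?L i) (min i (?R i)) (max i (?R i)))"
        by (simp add: e_def pm)
      have R: "?R permutes {0..<g}"
        by (rule permutes_subset[OF block_rev_permutes]) (use abk in auto)
      have L: "?L \<in> {0..<g} \<rightarrow>\<^sub>E {..r}"
        using l r by (auto simp: block_label_def)
      have mx: "(\<Sum>i = 0..<g. curve_wt g (\<phi> i) (min i (p i)) (max i (p i))) <
          (\<Sum>i = 0..<g. curve_wt g (?L i) (min i (?R i)) (max i (?R i)))"
        if "p permutes {0..<g}" "\<phi> \<in> {0..<g} \<rightarrow>\<^sub>E {..r}"
          "(\<Sum>i = 0..<g. Poly_Mapping.single (\<phi> i) 1) = m" "(p, \<phi>) \<noteq> (?R, ?L)"
          "\<And>i. i < g \<Longrightarrow> c (\<phi> i) (min i (p i)) (max i (p i)) \<noteq> 0" for p \<phi>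
      proof (rule curve_wt_less[OF abk that(1)])
        fix i assume i: "i < g" "\<phi> i < 2"
        then show "p i = i"
          using that(5)[OF i(1)] by (auto simp: c_def min_def max_def split: if_splits)
      qed (use that m_eq in auto)
      have deg: "degree (\<gamma> m) \<le> e m"
        unfolding em \<gamma>m
        by (rule mixdet_monom_leading(1)[OF R L block_label_type[OF abk, folded m_eq]]) (rule mx)
      have coeff: "poly.coeff (\<gamma> m) (e m) = signof ?R * (\<Prod>i = 0..<g. c (?L i) (min i (?R i)) (max i (?R i)))"
        unfolding em \<gamma>m
        by (rule mixdet_monom_leading(2)[OF R L block_label_type[OF abk, folded m_eq]]) (rule mx)
      have "(\<Prod>i = 0..<g. c (?L i) (min i (?R i)) (max i (?R i)))
        = (\<Prod>i\<in>{0..<a} \<union> {a..<a + k} \<union> {a + k..<g}. c (?L i) (min i (?R i)) (max i (?R i)))"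
        using abk by (intro prod.cong) auto
      also have "\<dots> = (\<Prod>i = 0..<a. c (?L i) (min i (?R i)) (max i (?R i)))
         * (\<Prod>i = a..<a + k. c (?L i) (min i (?R i)) (max i (?R i)))
         * (\<Prod>i = a + k..<g. c (?L i) (min i (?R i)) (max i (?R i)))"
        by (subst prod.union_disjoint, simp, simp, force, subst prod.union_disjoint) auto
      also have "(\<Prod>i = 0..<a. c (?L i) (min i (?R i)) (max i (?R i))) = (\<Prod>i = 0..<a. \<beta> i)"
        using abk by (intro prod.cong) (auto simp: c_def block_label_def block_rev_def)
      also have "(\<Prod>i = a + k..<g. c (?L i) (min i (?R i)) (max i (?R i))) = (\<Prod>i = a + k..<g. \<alpha> i)"
        using abk by (intro prod.cong) (auto simp: c_def block_label_def block_rev_def)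
      also have "(\<Prod>i = a..<a + k. c (?L i) (min i (?R i)) (max i (?R i)))
          = (\<Prod>i = a..<a + k. s l (min i (?R i)) (max i (?R i)))"
        using abk by (intro prod.cong) (auto simp: c_def block_label_def)
      also have "\<dots> = v l a k" by (rule s)
      finally have prod: "(\<Prod>i = 0..<g. c (?L i) (min i (?R i)) (max i (?R i))) = out a k * v l a k"
        by (simp add: out_def mult_ac)
      have "signof ?R * (out a k * v l a k) = \<tau> m"
      proof (cases "k = 0")
        case True
        then have "?R = id" by (auto simp: block_rev_def fun_eq_iff)
        moreover have "out a k = t a" using True abk out_0[of a] by simp
        moreover have "t a = \<tau> m" using True abk by (simp add: t_def m_eq flip: abk(1))
        ultimately show ?thesis using True by (simp add: v_def)
      next
        case False
        have "g - (a + k) = b" using abk by simp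
        then show ?thesis
          using False out_nz[of a k] sgn_nz[of ?R] by (simp add: v_def m_eq)
      qed
      then show ?thesis using deg coeff prod by metis
    qed
    moreover have "eval_mpoly (\<lambda>c. [:c:]) \<gamma> P = 0"
    proof -
      interpret C: comm_ring_hom "\<lambda>c :: 'k. [:c:]" by (rule comm_ring_hom_pCons)
      interpret E: comm_ring_hom "eval_mpoly (\<lambda>c :: 'k. [:c:]) x" by (rule C.comm_ring_hom_eval_mpoly)
      show ?thesis
        unfolding \<gamma>_def
        by (subst eval_mpoly_eval_mpoly[OF comm_ring_hom_pCons, symmetric]) (simp add: zero)
    qed
    ultimately show "\<exists>\<gamma>. (\<forall>v\<in>vars P. degree (\<gamma> v) \<le> e v \<and> poly.coeff (\<gamma> v) (e v) = \<tau> v)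
        \<and> eval_mpoly (\<lambda>c. [:c:]) \<gamma> P = 0"
      by blast
  qed
qed

section \<open>A slice for the action\<close>

text \<open>
  On the slice \<open>T\<^sup>(\<^sup>0\<^sup>)\<close> is a scalar matrix and \<open>T\<^sup>(\<^sup>1\<^sup>)\<close> is diagonal; the coordinates of the slice
  are named by those of the surviving entries.
\<close>

fun slice_coord :: "tvar \<Rightarrow> (tvar, 'k::field) mpoly" where
  "slice_coord (TVar l i j) =
     (if l = 0 then if i = j then Var (TVar 0 0 0) else 0
      else if l = 1 then if i = j then Var (TVar 1 i i) else 0
      else Var (TVar l i j))"

definition to_slice :: "(tvar, 'k::field) mpoly \<Rightarrow> (tvar, 'k) mpoly" where
  "to_slice = eval_mpoly Const slice_coord"

lemma comm_ring_hom_to_slice: "comm_ring_hom to_slice"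
proof -
  interpret C: comm_ring_hom "Const :: 'a \<Rightarrow> (tvar, 'a) mpoly" by (rule comm_ring_hom_Const)
  show ?thesis unfolding to_slice_def by (rule C.comm_ring_hom_eval_mpoly)
qed

lemmas eval_hom = comm_ring_hom.comm_ring_hom_eval_mpoly[OF comm_ring_hom_id]

lemmas eval_Const [simp] = comm_ring_hom.eval_mpoly_Const[OF comm_ring_hom_id]

lemmas eval_Var [simp] = comm_ring_hom.eval_mpoly_Var[OF comm_ring_hom_id]

definition point_mat :: "nat \<Rightarrow> (tvar \<Rightarrow> 'k) \<Rightarrow> nat \<Rightarrow> 'k mat" where
  "point_mat g x l = mat g g (\<lambda>(i, j). x (TVar l (min i j) (max i j)))"

lemma point_mat_carrier [simp]: "point_mat g x l \<in> carrier_mat g g"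
  by (simp add: point_mat_def)

text \<open>Evaluating the polynomial identity \<open>SL_act g \<Lambda> f = f\<close> at a point
  turns it into equality of values at two congruent tuples. \<open>y\<close> is constrained only at
  variables with i \<le> j < g, the only ones that can occur in \<open>f\<close>.\<close>

lemma eval_invariant:
  assumes f: "f \<in> SL_invariants g r" and N: "N \<in> carrier_mat g g" "N * \<Lambda> = 1\<^sub>m g"
    and \<Lambda>: "\<Lambda> \<in> carrier_mat g g" "det \<Lambda> = (1 :: 'k::field)"
    and y: "\<And>l i j. i \<le> j \<Longrightarrow> j < g \<Longrightarrow> y (TVar l i j) = (N * point_mat g x l * transpose_mat N) $$ (i, j)"
  shows "eval_mpoly (\<lambda>c. c) x f = eval_mpoly (\<lambda>c. c) y f"
proof -
  interpret E: comm_ring_hom "eval_mpoly (\<lambda>c :: 'k. c) x" by (rule eval_hom)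
  define M where "M = map_mat (Const :: 'k \<Rightarrow> (tvar, 'k) mpoly) N"
  have M: "M \<in> carrier_mat g g" using N by (simp add: M_def)
  have inv: "mat_inverse \<Lambda> = Some N"
    by (rule mat_inverse_eqI[OF \<Lambda>(1) N \<Lambda>(2)])
  have "\<Lambda> \<in> SL g" using \<Lambda> by (simp add: SL_def)
  then have "SL_act g \<Lambda> f = f" using f by (auto simp: SL_invariants_def)
  then have "eval_mpoly (\<lambda>c. c) x f = eval_mpoly (\<lambda>c. c) x (SL_act g \<Lambda> f)" by simp
  also have "\<dots> = eval_mpoly (\<lambda>c. c) (\<lambda>v. eval_mpoly (\<lambda>c. c) x
      (case v of TVar l i j \<Rightarrow> (M * T_mat g l * transpose_mat M) $$ (i, j))) f"
    unfolding SL_act_def Let_def inv option.sel M_def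
    by (rule eval_mpoly_eval_mpoly[OF comm_ring_hom_id])
  also have "\<dots> = eval_mpoly (\<lambda>c. c) y f"
  proof (rule eval_mpoly_cong)
    fix v assume "v \<in> vars f"
    then have "v \<in> tvars g r" using f by (auto simp: SL_invariants_def T_ring_def)
    then obtain l i j where v: "v = TVar l i j" and ij: "i \<le> j" "j < g" by (auto simp: tvars_def)
    then have "i < g" by simp
    have "eval_mpoly (\<lambda>c. c) x ((M * T_mat g l * transpose_mat M) $$ (i, j))
        = (N * point_mat g x l * transpose_mat N) $$ (i, j)"
      unfolding index_congruence_mat[OF M T_mat_carrier \<open>i < g\<close> \<open>j < g\<close>]
        index_congruence_mat[OF N(1) point_mat_carrier \<open>i < g\<close> \<open>j < g\<close>]
      using N(1) ij by (auto simp: hom_distribs M_def T_mat_def point_mat_def intro!: sum.cong)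
    then show "eval_mpoly (\<lambda>c. c) x (case v of TVar l i j \<Rightarrow> (M * T_mat g l * transpose_mat M) $$ (i, j)) = y v"
      using y[OF ij] by (simp add: v)
  qed
  finally show ?thesis .
qed

text \<open>The matrix M / \<mu> with \<mu>^g = det M lies in the special linear group. Acting by it
  moves the point to T^(0) = \<mu>^2 I and T^(1) = \<mu>^2 D, hence onto the slice, where
  \<open>f\<close> vanishes. This scaling is why T^(0) is allowed to be any scalar matrix on the
  slice instead of the identity only.\<close>

lemma eval_0_if_to_slice_0:
  fixes f :: "(tvar, 'k::alg_closed_field) mpoly"
  assumes g: "g \<ge> 1" and f: "f \<in> SL_invariants g r" "to_slice f = 0"
    and M: "M \<in> carrier_mat g g" "det M \<noteq> 0"
    and D: "D = mat g g (\<lambda>(i, j). if i = j then d i else 0)"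
    and X0: "point_mat g x 0 = M * transpose_mat M"
    and X1: "point_mat g x 1 = M * D * transpose_mat M"
  shows "eval_mpoly (\<lambda>c. c) x f = 0"
proof -
  obtain \<mu> where \<mu>: "\<mu> ^ g = det M"
    using nth_root_exists[of g "det M"] g by auto
  have \<mu>0: "\<mu> \<noteq> 0" using \<mu> M(2) g by (metis not_one_le_zero power_eq_0_iff zero_less_iff_neq_zero)
  define \<Lambda> where "\<Lambda> = (1 / \<mu>) \<cdot>\<^sub>m M"
  have \<Lambda>: "\<Lambda> \<in> carrier_mat g g" "det \<Lambda> = 1"
    using M \<mu> \<mu>0 by (auto simp: \<Lambda>_def power_divide)
  have "\<Lambda> \<in> SL g" using \<Lambda> by (simp add: SL_def)
  then obtain N where N: "mat_inverse \<Lambda> = Some N" "N \<in> carrier_mat g g"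
    using SL_inverse by blast
  have N\<Lambda>: "N * \<Lambda> = 1\<^sub>m g" using mat_inverse(2)[OF \<Lambda>(1) N(1)] by simp
  have "M = \<mu> \<cdot>\<^sub>m \<Lambda>" using \<mu>0 M by (auto simp: \<Lambda>_def)
  then have NM: "N * M = \<mu> \<cdot>\<^sub>m 1\<^sub>m g"
    using N(2) \<Lambda>(1) N\<Lambda> by (simp add: mult_smult_distrib)
  have Dc: "D \<in> carrier_mat g g" by (simp add: D)
  have conj: "N * (M * B * transpose_mat M) * transpose_mat N = N * M * B * transpose_mat (N * M)"
    if "B \<in> carrier_mat g g" for B
    using that N(2) M(1) by (simp add: transpose_mult[of N g g M g] assoc_mult_mat[of _ g g _ g _ g])
  have ent: "(N * (M * B * transpose_mat M) * transpose_mat N) $$ (i, j) = \<mu>\<^sup>2 * B $$ (i, j)"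
    if "B \<in> carrier_mat g g" "i < g" "j < g" for B i j
    unfolding conj[OF that(1)] NM using that
    by (auto simp: index_congruence_mat[of _ g] sum.delta if_distrib[of "\<lambda>x. x * _"] if_distrib[of "\<lambda>x. _ * x"]
        power2_eq_square cong: if_cong)
  define y where "y = (\<lambda>TVar l i j \<Rightarrow> (N * point_mat g x l * transpose_mat N) $$ (i, j))"
  have "eval_mpoly (\<lambda>c. c) x f = eval_mpoly (\<lambda>c. c) y f"
    by (rule eval_invariant[OF f(1) N(2) N\<Lambda> \<Lambda>]) (simp add: y_def)
  also have "\<dots> = eval_mpoly (\<lambda>c. c) (\<lambda>v. eval_mpoly (\<lambda>c. c) y (slice_coord v)) f"
  proof (rule eval_mpoly_cong)
    interpret E: comm_ring_hom "eval_mpoly (\<lambda>c :: 'k. c) y" by (rule eval_hom)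
    fix v assume "v \<in> vars f"
    then have "v \<in> tvars g r" using f by (auto simp: SL_invariants_def T_ring_def)
    then obtain l i j where v: "v = TVar l i j" and ij: "i \<le> j" "j < g" by (auto simp: tvars_def)
    have y0: "y (TVar 0 i j) = (if i = j then \<mu>\<^sup>2 else 0)" if "i < g" "j < g" for i j
    proof -
      have "point_mat g x 0 = M * 1\<^sub>m g * transpose_mat M"
        unfolding right_mult_one_mat[OF M(1)] by (rule X0)
      then show ?thesis using ent[of "1\<^sub>m g" i j] that by (simp add: y_def)
    qed
    have y1: "y (TVar 1 i j) = (if i = j then \<mu>\<^sup>2 * d i else 0)" if "i < g" "j < g" for i j
      using ent[OF Dc, of i j] that by (simp add: y_def X1[unfolded One_nat_def] D)
    show "y v = eval_mpoly (\<lambda>c. c) y (slice_coord v)"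
      using ij y0[of i j] y0[of 0 0] y1[of i j] y1[of i i] by (simp add: v)
  qed
  also have "\<dots> = eval_mpoly (\<lambda>c. c) y (to_slice f)"
    unfolding to_slice_def by (rule eval_mpoly_eval_mpoly[OF comm_ring_hom_id, symmetric])
  also have "\<dots> = 0" by (simp add: f(2) eval_mpoly_def)
  finally show ?thesis .
qed

lemma degree_coeff_sum_monom:
  assumes "finite A" "k0 \<in> A" "\<And>k. k \<in> A \<Longrightarrow> k \<noteq> k0 \<Longrightarrow> u k < u k0"
  shows "degree (\<Sum>k\<in>A. monom (c k) (u k)) \<le> u k0 \<and> poly.coeff (\<Sum>k\<in>A. monom (c k) (u k)) (u k0) = c k0"
proof
  show "degree (\<Sum>k\<in>A. monom (c k) (u k)) \<le> u k0"
  proof (rule degree_sum_le[OF assms(1)])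
    fix k assume "k \<in> A"
    then have "u k \<le> u k0" using assms(3)[of k] by (cases "k = k0") auto
    then show "degree (monom (c k) (u k)) \<le> u k0"
      using degree_monom_le[of "c k" "u k"] by linarith
  qed
  have "poly.coeff (\<Sum>k\<in>A. monom (c k) (u k)) (u k0) = (\<Sum>k\<in>A. if k = k0 then c k0 else 0)"
    unfolding coeff_sum
  proof (rule sum.cong[OF refl])
    fix k assume "k \<in> A"
    then show "poly.coeff (monom (c k) (u k)) (u k0) = (if k = k0 then c k0 else 0)"
      using assms(3)[of k] by (cases "k = k0") auto
  qed
  then show "poly.coeff (\<Sum>k\<in>A. monom (c k) (u k)) (u k0) = c k0" using assms by simp
qed

lemma vars_det_T_mat: "vars (det (T_mat g 0) :: (tvar, 'k::field) mpoly) \<subseteq> tvars g r"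
  unfolding det_def'[OF T_mat_carrier]
proof (rule vars_sum)
  fix p assume p: "p \<in> {p. p permutes {0..<g}}"
  have "vars (\<Prod>i = 0..<g. T_mat g 0 $$ (i, p i) :: (tvar, 'k) mpoly) \<subseteq> tvars g r"
  proof (rule vars_prod)
    fix i assume "i \<in> {0..<g}"
    then have "i < g" "p i < g" using p permutes_in_image[of p "{0..<g}" i] by auto
    then show "vars (T_mat g 0 $$ (i, p i) :: (tvar, 'k) mpoly) \<subseteq> tvars g r"
      by (auto simp: T_mat_def tvars_def min_def max_def)
  qed
  then show "vars (signof p * (\<Prod>i = 0..<g. T_mat g 0 $$ (i, p i)) :: (tvar, 'k) mpoly) \<subseteq> tvars g r"
    by (auto simp: sign_def)
qed

lemma eval_det_T_mat:
  "eval_mpoly (\<lambda>c. c) x (det (T_mat g l) :: (tvar, 'k::field) mpoly) = det (point_mat g x l)"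
proof -
  interpret E: comm_ring_hom "eval_mpoly (\<lambda>c :: 'k. c) x" by (rule eval_hom)
  have "map_mat (eval_mpoly (\<lambda>c. c) x) (T_mat g l) = point_mat g x l"
    by (rule eq_matI) (auto simp: T_mat_def point_mat_def)
  then show ?thesis by (simp flip: E.hom_det)
qed

lemma det_T_mat_ne_0: "det (T_mat g l :: (tvar, 'k::field) mpoly mat) \<noteq> 0"
proof
  define x :: "tvar \<Rightarrow> 'k" where "x = (\<lambda>TVar l i j \<Rightarrow> if i = j then 1 else 0)"
  assume "det (T_mat g l :: (tvar, 'k) mpoly mat) = 0"
  then have "det (point_mat g x l) = 0"
    using eval_det_T_mat[of x g l] by (simp add: eval_mpoly_def)
  moreover have "point_mat g x l = 1\<^sub>m g"
    by (rule eq_matI) (auto simp: point_mat_def x_def min_def max_def)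
  ultimately show False by simp
qed

text \<open>
  Along the curves \<open>T\<^sup>(\<^sup>0\<^sup>) = L L\<^sup>t\<close>, \<open>T\<^sup>(\<^sup>1\<^sup>) = L D L\<^sup>t\<close> used here, the weights of the entries of \<open>L\<close> and
  \<open>D\<close> are chosen such that the \<open>(i, j)\<close> entries with \<open>i \<le> j\<close> have the leading terms
  \<open>L\<^sub>i\<^sub>i L\<^sub>j\<^sub>i\<close> and \<open>L\<^sub>i\<^sub>j d\<^sub>j L\<^sub>j\<^sub>j\<close>; these can be prescribed arbitrarily. The factor \<open>det T\<^sup>(\<^sup>0\<^sup>)\<close> takes
  care of the points where \<open>L\<close> is singular.
\<close>

lemma to_slice_eq_0D:
  fixes f :: "(tvar, 'k::alg_closed_field) mpoly"
  assumes g: "g \<ge> 1" and f: "f \<in> SL_invariants g r" "to_slice f = 0"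
  shows "f = 0"
proof -
  define F where "F = f * det (T_mat g 0)"
  have vF: "vars F \<subseteq> tvars g r"
    unfolding F_def using f vars_mult[of f "det (T_mat g 0)"] vars_det_T_mat[of g r]
    by (auto simp: SL_invariants_def T_ring_def)
  \<comment> \<open>For i \<le> j, \<open>w i k + w j k\<close> is continuous and piecewise linear
    in k, with slopes 2, -3, -8 and breaks at i and j, so it peaks at k = i. Adding the weight 6k of
    the k-th entry of D changes the slopes to 8, 3, -2 and moves the peak to k = j. The offset 4g
    keeps the natural subtraction exact for k < g.\<close>
  define w where "w i k = (if k \<le> i then 4 * g + k else 4 * g + 5 * i - 4 * k)" for i k
  define e where "e = (\<lambda>TVar l i j \<Rightarrow> if l = 0 then 8 * g + 2 * i else if l = 1 then 8 * g + 5 * i + 3 * j else 0)"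
  have "F = 0"
  proof (rule mpoly_eq_0_if_0_on_curves[where e = e])
    fix \<tau> :: "tvar \<Rightarrow> 'k"
    assume \<tau>: "\<And>v. \<tau> v \<noteq> 0"
    have "\<exists>y. y ^ 2 = x" for x :: 'k
      using nth_root_exists[of 2 x] by auto
    then obtain sq :: "'k \<Rightarrow> 'k" where sq: "\<And>x. sq x ^ 2 = x" by metis
    define rt where "rt i = sq (\<tau> (TVar 0 i i))" for i
    have rt: "rt i * rt i = \<tau> (TVar 0 i i)" for i
      using sq by (simp add: rt_def flip: power2_eq_square)
    then have rt0: "rt i \<noteq> 0" for i using \<tau> by (metis mult_zero_left)
    define d where "d i = \<tau> (TVar 1 i i) / \<tau> (TVar 0 i i)" for i
    have d0: "d i \<noteq> 0" for i using \<tau> by (simp add: d_def)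
    \<comment> \<open>Obtained by solving the leading terms: L_ii^2 and L_ii L_ji give the
      prescribed entries of T^(0), and d_i L_ii^2 and L_ij d_j L_jj those of T^(1), for i < j. The
      entries of L below and above the diagonal therefore do not interfere.\<close>
    define c where "c i k = (if k = i then rt i else if k < i then \<tau> (TVar 0 k i) / rt k
      else \<tau> (TVar 1 i k) / (d k * rt k))" for i k
    define L where "L i k = monom (c i k) (w i k)" for i k
    define \<gamma> where "\<gamma> = (\<lambda>TVar l i j \<Rightarrow> if l = 0 then \<Sum>k = 0..<g. L i k * L j k
      else if l = 1 then \<Sum>k = 0..<g. monom (d k) (6 * k) * (L i k * L j k) else [:\<tau> (TVar l i j):])"
    have "degree (\<gamma> v) \<le> e v \<and> poly.coeff (\<gamma> v) (e v) = \<tau> v" if v: "v \<in> vars F" for v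
    proof -
      obtain l i j where v: "v = TVar l i j" and ij: "i \<le> j" "j < g"
        using v vF by (auto simp: tvars_def)
      consider "l = 0" | "l = 1" | "l \<ge> 2" by linarith
      then show ?thesis
      proof cases
        case 1
        have "\<gamma> v = (\<Sum>k\<in>{0..<g}. monom (c i k * c j k) (w i k + w j k))"
          by (simp add: \<gamma>_def v 1 L_def mult_monom)
        moreover have "w i k + w j k < w i i + w j i" if "k \<in> {0..<g}" "k \<noteq> i" for k
          using that ij by (auto simp: w_def)
        moreover have "w i i + w j i = e v" using ij by (simp add: w_def e_def v 1)
        moreover have "c i i * c j i = \<tau> v"
          using ij rt rt0 by (auto simp: c_def v 1)
        ultimately show ?thesis
          using degree_coeff_sum_monom[of "{0..<g}" i "\<lambda>k. w i k + w j k" "\<lambda>k. c i k * c j k"] ij by simp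
      next
        case 2
        have "\<gamma> v = (\<Sum>k\<in>{0..<g}. monom (d k * (c i k * c j k)) (6 * k + (w i k + w j k)))"
          by (simp add: \<gamma>_def v 2 L_def mult_monom)
        moreover have "6 * k + (w i k + w j k) < 6 * j + (w i j + w j j)" if "k \<in> {0..<g}" "k \<noteq> j" for k
          using that ij by (auto simp: w_def)
        moreover have "6 * j + (w i j + w j j) = e v" using ij by (auto simp: w_def e_def v 2)
        moreover have "d j * (c i j * c j j) = \<tau> v"
          using ij rt rt0 d0 \<tau> by (auto simp: c_def v 2 d_def)
        ultimately show ?thesis
          using degree_coeff_sum_monom[of "{0..<g}" j "\<lambda>k. 6 * k + (w i k + w j k)" "\<lambda>k. d k * (c i k * c j k)"] ij
          by simp
      next
        case 3
        then show ?thesis by (simp add: \<gamma>_def e_def v)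
      qed
    qed
    moreover have "eval_mpoly (\<lambda>c. [:c:]) \<gamma> F = 0"
    proof (rule ccontr)
      assume nz: "eval_mpoly (\<lambda>c. [:c:]) \<gamma> F \<noteq> 0"
      \<comment> \<open>Over an infinite field it suffices to check every value of t. There the
        first two matrices are M M^t and M D M^t: a singular M kills the determinant factor of
        \<open>F\<close>, and an invertible one kills \<open>f\<close> by
        \<open>eval_0_if_to_slice_0\<close>.\<close>
      have "poly (eval_mpoly (\<lambda>c. [:c:]) \<gamma> F) t = 0" for t
      proof -
        interpret P: comm_ring_hom "\<lambda>p :: 'k poly. poly p t" by (rule comm_ring_hom_poly)
        define x where "x v = poly (\<gamma> v) t" for v
        define M where "M = mat g g (\<lambda>(i, k). poly (L i k) t)"
        define D where "D = mat g g (\<lambda>(i, j). if i = j then poly (monom (d i) (6 * i)) t else 0)"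
        have M: "M \<in> carrier_mat g g" by (simp add: M_def)
        have Dc: "D \<in> carrier_mat g g" by (simp add: D_def)
        have X0: "point_mat g x 0 = M * transpose_mat M"
        proof (rule eq_matI)
          fix i j assume "i < dim_row (M * transpose_mat M)" "j < dim_col (M * transpose_mat M)"
          then show "point_mat g x 0 $$ (i, j) = (M * transpose_mat M) $$ (i, j)"
            by (cases "i \<le> j") (auto simp: point_mat_def x_def \<gamma>_def M_def scalar_prod_def poly_sum mult.commute)
        qed (simp_all add: M_def point_mat_def)
        have X1: "point_mat g x 1 = M * D * transpose_mat M"
        proof (rule eq_matI)
          fix i j assume "i < dim_row (M * D * transpose_mat M)" "j < dim_col (M * D * transpose_mat M)"
          then have ij: "i < g" "j < g" by (simp_all add: M_def)
          have "(\<Sum>a = 0..<g. \<Sum>b = 0..<g. M $$ (i, a) * D $$ (a, b) * M $$ (j, b))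
              = (\<Sum>a = 0..<g. poly (monom (d a) (6 * a)) t * (poly (L i a) t * poly (L j a) t))"
          proof (rule sum.cong[OF refl])
            fix a assume a: "a \<in> {0..<g}"
            have "(\<Sum>b = 0..<g. M $$ (i, a) * D $$ (a, b) * M $$ (j, b))
                = (\<Sum>b = 0..<g. if b = a then M $$ (i, a) * D $$ (a, a) * M $$ (j, a) else 0)"
              using a by (intro sum.cong refl) (auto simp: D_def)
            also have "\<dots> = M $$ (i, a) * D $$ (a, a) * M $$ (j, a)"
              using a by simp
            finally show "(\<Sum>b = 0..<g. M $$ (i, a) * D $$ (a, b) * M $$ (j, b))
                = poly (monom (d a) (6 * a)) t * (poly (L i a) t * poly (L j a) t)"
              using a ij by (simp add: M_def D_def)
          qed
          also have "\<dots> = point_mat g x 1 $$ (i, j)"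
            using ij by (cases "i \<le> j") (auto simp: point_mat_def x_def \<gamma>_def poly_sum mult.commute)
          finally show "point_mat g x 1 $$ (i, j) = (M * D * transpose_mat M) $$ (i, j)"
            by (simp add: index_congruence_mat[OF M Dc ij])
        qed (simp_all add: M_def point_mat_def)
        have "poly (eval_mpoly (\<lambda>c. [:c:]) \<gamma> F) t = eval_mpoly (\<lambda>c. c) x F"
          unfolding x_def by (rule P.hom_eval_mpoly) simp
        also have "\<dots> = eval_mpoly (\<lambda>c. c) x f * det (point_mat g x 0)"
          by (simp add: F_def comm_ring_hom.eval_mpoly_mult[OF comm_ring_hom_id] eval_det_T_mat)
        also have "\<dots> = 0"
        proof (cases "det M = 0")
          case True
          then show ?thesis using M by (simp add: X0 det_mult[of _ g])
        next
          case False
          then show ?thesis using eval_0_if_to_slice_0[OF g f M False D_def X0 X1] by simp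
        qed
        finally show ?thesis .
      qed
      then have "{t. poly (eval_mpoly (\<lambda>c. [:c:]) \<gamma> F) t = 0} = UNIV" by simp
      then show False
        using poly_roots_finite[OF nz] infinite_UNIV_alg_closed[where 'k = 'k] by simp
    qed
    ultimately show "\<exists>\<gamma>. (\<forall>v\<in>vars F. degree (\<gamma> v) \<le> e v \<and> poly.coeff (\<gamma> v) (e v) = \<tau> v)
        \<and> eval_mpoly (\<lambda>c. [:c:]) \<gamma> F = 0"
      by blast
  qed
  then show ?thesis using det_T_mat_ne_0[of g 0, where 'k = 'k] by (simp add: F_def)
qed

section \<open>Algebraic dependence by counting monomials\<close>

text \<open>Bounding each exponent separately, and not the total degree, makes the number of
  monomials an exact power, while the bounds still add up in products.\<close>

definition box_monoms :: "'v set \<Rightarrow> nat \<Rightarrow> ('v \<Rightarrow>\<^sub>0 nat) set" where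
  "box_monoms V n = {m. Poly_Mapping.keys m \<subseteq> V \<and> (\<forall>v. Poly_Mapping.lookup m v \<le> n)}"

lemma bij_betw_box_monoms:
  assumes "finite V"
  shows "bij_betw (\<lambda>m. restrict (Poly_Mapping.lookup m) V) (box_monoms V n) (V \<rightarrow>\<^sub>E {..n})"
proof (rule bij_betw_imageI)
  show "inj_on (\<lambda>m. restrict (Poly_Mapping.lookup m) V) (box_monoms V n)"
  proof (rule inj_onI)
    fix m m' :: "'a \<Rightarrow>\<^sub>0 nat"
    assume mm: "m \<in> box_monoms V n" "m' \<in> box_monoms V n"
      and eq: "restrict (Poly_Mapping.lookup m) V = restrict (Poly_Mapping.lookup m') V"
    show "m = m'"
    proof (rule poly_mapping_eqI)
      fix v
      show "Poly_Mapping.lookup m v = Poly_Mapping.lookup m' v"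
      proof (cases "v \<in> V")
        case True
        then show ?thesis using fun_cong[OF eq, of v] by simp
      next
        case False
        then have "v \<notin> Poly_Mapping.keys m" "v \<notin> Poly_Mapping.keys m'"
          using mm by (auto simp: box_monoms_def)
        then show ?thesis by (simp add: in_keys_iff)
      qed
    qed
  qed
  show "(\<lambda>m. restrict (Poly_Mapping.lookup m) V) ` box_monoms V n = V \<rightarrow>\<^sub>E {..n}"
  proof
    show "(\<lambda>m. restrict (Poly_Mapping.lookup m) V) ` box_monoms V n \<subseteq> V \<rightarrow>\<^sub>E {..n}"
      by (auto simp: box_monoms_def)
    show "V \<rightarrow>\<^sub>E {..n} \<subseteq> (\<lambda>m. restrict (Poly_Mapping.lookup m) V) ` box_monoms V n"
    proof
      fix f assume f: "f \<in> V \<rightarrow>\<^sub>E {..n}"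
      define m where "m = (\<Sum>v\<in>V. Poly_Mapping.single v (f v))"
      have l: "Poly_Mapping.lookup m v = (if v \<in> V then f v else 0)" for v
        using assms by (simp add: m_def lookup_sum lookup_single when_def)
      then have "m \<in> box_monoms V n"
        using f by (auto simp: box_monoms_def in_keys_iff split: if_splits)
      moreover have "f = restrict (Poly_Mapping.lookup m) V"
      proof
        fix v
        show "f v = restrict (Poly_Mapping.lookup m) V v"
          using PiE_arb[OF f, of v] by (cases "v \<in> V") (simp_all add: l)
      qed
      ultimately show "f \<in> (\<lambda>m. restrict (Poly_Mapping.lookup m) V) ` box_monoms V n"
        by (rule rev_image_eqI)
    qed
  qed
qed

lemma finite_box_monoms: "finite V \<Longrightarrow> finite (box_monoms V n)"
  using bij_betw_finite[OF bij_betw_box_monoms[of V n]] by (simp add: finite_PiE)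

lemma card_box_monoms: "finite V \<Longrightarrow> card (box_monoms V n) = (n + 1) ^ card V"
  using bij_betw_same_card[OF bij_betw_box_monoms[of V n]] by (simp add: card_PiE)

lemma box_monoms_mono: "a \<le> b \<Longrightarrow> box_monoms V a \<subseteq> box_monoms V b"
  by (auto simp: box_monoms_def intro: order_trans)

lemma keys_mult_box_monoms:
  assumes "Poly_Mapping.keys p \<subseteq> box_monoms V a" "Poly_Mapping.keys q \<subseteq> box_monoms V b"
  shows "Poly_Mapping.keys (p * q :: ('v, 'a::comm_ring_1) mpoly) \<subseteq> box_monoms V (a + b)"
proof
  fix m assume "m \<in> Poly_Mapping.keys (p * q)"
  then obtain x y where m: "m = x + y" "x \<in> Poly_Mapping.keys p" "y \<in> Poly_Mapping.keys q"
    using keys_mult[of p q] by auto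
  then have "x \<in> box_monoms V a" "y \<in> box_monoms V b" using assms by auto
  then show "m \<in> box_monoms V (a + b)"
    using keys_add[of x y] by (auto simp: box_monoms_def m(1) lookup_add intro!: add_mono)
qed

lemma keys_prod_box_monoms:
  assumes "\<And>i. i \<in> A \<Longrightarrow> Poly_Mapping.keys (f i) \<subseteq> box_monoms V (b i)"
  shows "Poly_Mapping.keys (prod f A :: ('v, 'a::comm_ring_1) mpoly) \<subseteq> box_monoms V (sum b A)"
  using assms
proof (induction A rule: infinite_finite_induct)
  case (insert x F)
  then show ?case using keys_mult_box_monoms[of "f x" V "b x" "prod f F" "sum b F"] by simp
qed (auto simp: box_monoms_def)

lemma keys_power_box_monoms:
  assumes "Poly_Mapping.keys p \<subseteq> box_monoms V b"
  shows "Poly_Mapping.keys (p ^ n :: ('v, 'a::comm_ring_1) mpoly) \<subseteq> box_monoms V (n * b)"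
  using keys_prod_box_monoms[of "{..<n}" "\<lambda>_. p" V "\<lambda>_. b"] assms by simp

lemma ex_box_monoms:
  assumes "finite A" "\<And>p. p \<in> A \<Longrightarrow> vars (p :: ('v, 'a::zero) mpoly) \<subseteq> V"
  shows "\<exists>b. \<forall>p\<in>A. Poly_Mapping.keys p \<subseteq> box_monoms V b"
proof -
  define S where "S = (\<Union>p\<in>A. \<Union>m\<in>Poly_Mapping.keys p. Poly_Mapping.lookup m ` Poly_Mapping.keys m)"
  have "finite S" using assms(1) by (simp add: S_def)
  have "Poly_Mapping.keys p \<subseteq> box_monoms V (Max (insert 0 S))" if p: "p \<in> A" for p
  proof
    fix m assume m: "m \<in> Poly_Mapping.keys p"
    have "Poly_Mapping.lookup m v \<le> Max (insert 0 S)" for v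
    proof (cases "v \<in> Poly_Mapping.keys m")
      case True
      then have "Poly_Mapping.lookup m v \<in> S" using p m by (auto simp: S_def)
      then show ?thesis using \<open>finite S\<close> by simp
    next
      case False
      then show ?thesis by (simp add: in_keys_iff)
    qed
    moreover have "Poly_Mapping.keys m \<subseteq> V"
      using assms(2)[OF p] m by (auto simp: vars_def)
    ultimately show "m \<in> box_monoms V (Max (insert 0 S))" by (simp add: box_monoms_def)
  qed
  then show ?thesis by blast
qed

text \<open>Gaussian elimination, by induction on the set of equations. An equation with a nonzero
  coefficient at \<open>a0\<close> is used to eliminate that unknown from the others
  (\<open>M'\<close>), and its value is restored by back substitution (\<open>c'\<close>).\<close>

lemma homogeneous_system_solution:
  fixes M :: "'a \<Rightarrow> 'e \<Rightarrow> 'k::field"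
  assumes "finite E" "finite A" "card E < card A"
  shows "\<exists>c. (\<exists>a\<in>A. c a \<noteq> 0) \<and> (\<forall>e\<in>E. (\<Sum>a\<in>A. c a * M a e) = 0)"
  using assms
proof (induction E arbitrary: A M rule: finite_induct)
  case empty
  then have "A \<noteq> {}" by auto
  then show ?case by (intro exI[of _ "\<lambda>_. 1"]) auto
next
  case (insert e E)
  show ?case
  proof (cases "\<forall>a\<in>A. M a e = 0")
    case True
    obtain c where "\<exists>a\<in>A. c a \<noteq> 0" "\<forall>e\<in>E. (\<Sum>a\<in>A. c a * M a e) = 0"
      using insert.IH[of A M] insert.prems insert.hyps by auto
    then show ?thesis using True by (intro exI[of _ c]) auto
  next
    case False
    then obtain a0 where a0: "a0 \<in> A" "M a0 e \<noteq> 0" by blast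
    define M' where "M' a x = M a x - M a e / M a0 e * M a0 x" for a x
    have "card E < card (A - {a0})"
      using insert.prems insert.hyps a0 by simp
    then obtain c where c: "\<exists>a\<in>A - {a0}. c a \<noteq> 0" "\<forall>x\<in>E. (\<Sum>a\<in>A - {a0}. c a * M' a x) = 0"
      using insert.IH[of "A - {a0}" M'] insert.prems by auto
    define s where "s = (\<Sum>a\<in>A - {a0}. c a * M a e)"
    define c' where "c' a = (if a = a0 then - s / M a0 e else c a)" for a
    have split: "(\<Sum>a\<in>A. c' a * M a x) = (\<Sum>a\<in>A - {a0}. c a * M a x) - s / M a0 e * M a0 x" for x
    proof -
      have "(\<Sum>a\<in>A. c' a * M a x) = c' a0 * M a0 x + (\<Sum>a\<in>A - {a0}. c' a * M a x)"
        using a0 insert.prems by (intro sum.remove) auto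
      also have "(\<Sum>a\<in>A - {a0}. c' a * M a x) = (\<Sum>a\<in>A - {a0}. c a * M a x)"
        by (intro sum.cong) (auto simp: c'_def)
      finally show ?thesis by (simp add: c'_def)
    qed
    have "(\<Sum>a\<in>A. c' a * M a x) = 0" if "x \<in> insert e E" for x
    proof (cases "x = e")
      case True
      then show ?thesis using split[of e] a0 by (simp add: s_def)
    next
      case False
      then have "0 = (\<Sum>a\<in>A - {a0}. c a * M' a x)" using c that by auto
      also have "\<dots> = (\<Sum>a\<in>A - {a0}. c a * M a x - c a * M a e * (M a0 x / M a0 e))"
        by (intro sum.cong) (auto simp: M'_def algebra_simps)
      also have "\<dots> = (\<Sum>a\<in>A - {a0}. c a * M a x) - s * (M a0 x / M a0 e)"
        by (simp only: sum_subtractf s_def sum_distrib_right)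
      finally show ?thesis by (simp add: split)
    qed
    moreover have "\<exists>a\<in>A. c' a \<noteq> 0" using c(1) by (auto simp: c'_def)
    ultimately show ?thesis by (intro exI[of _ c']) auto
  qed
qed

lemma lookup_Const_mult: "Poly_Mapping.lookup (Const c * p :: ('v, 'a::comm_ring_1) mpoly) m = c * Poly_Mapping.lookup p m"
proof -
  have "Const c * p = Poly_Mapping.map ((*) c) p"
    unfolding Const_def by (rule mult_map_scale_conv_mult[symmetric])
  then show ?thesis by (simp add: map.rep_eq when_def)
qed

text \<open>
  There are more products \<open>p\<^sup>i q\<^sup>D\<^sup>-\<^sup>i \<theta>\<^sup>\<alpha>\<close> with \<open>i \<le> D\<close> and all exponents of \<open>\<alpha>\<close> at most \<open>n\<close> than
  monomials that can occur in them, if \<open>D\<close> and then \<open>n\<close> are large.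
\<close>

lemma ex_homogeneous_relation:
  fixes p q :: "('w, 'k::field) mpoly" and \<theta> :: "'i \<Rightarrow> ('w, 'k) mpoly"
  assumes fin: "finite Z" "finite I" and card: "card Z \<le> card I"
    and vars: "vars p \<subseteq> Z" "vars q \<subseteq> Z" "\<And>i. i \<in> I \<Longrightarrow> vars (\<theta> i) \<subseteq> Z"
  shows "\<exists>D P. (\<forall>i\<le>D. vars (P i) \<subseteq> I) \<and> (\<exists>i\<le>D. P i \<noteq> 0) \<and>
     (\<Sum>i\<le>D. p ^ i * q ^ (D - i) * eval_mpoly Const \<theta> (P i)) = 0"
proof -
  interpret C: comm_ring_hom "Const :: 'k \<Rightarrow> ('w, 'k) mpoly" by (rule comm_ring_hom_Const)
  obtain d where d: "Poly_Mapping.keys p \<subseteq> box_monoms Z d" "Poly_Mapping.keys q \<subseteq> box_monoms Z d"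
    "\<And>i. i \<in> I \<Longrightarrow> Poly_Mapping.keys (\<theta> i) \<subseteq> box_monoms Z d"
  proof -
    have "vars f \<subseteq> Z" if "f \<in> insert p (insert q (\<theta> ` I))" for f
      using vars that by auto
    then have "\<exists>d. \<forall>f\<in>insert p (insert q (\<theta> ` I)). Poly_Mapping.keys f \<subseteq> box_monoms Z d"
      using fin by (intro ex_box_monoms) auto
    then show thesis using that by auto
  qed
  \<comment> \<open>\<open>c'\<close> bounds the exponents in \<theta>^\<alpha> per unit of the
    bound on \<alpha>. The choice n = D d gives b = n (c' + 1), hence b + 1 \<le> (c' + 1) (n + 1).
    The choice of \<open>D\<close> then leaves at most D (n + 1)^|I| monomials for (D + 1) (n +
    1)^|I| products.\<close>
  define c' where "c' = card I * d"
  define D where "D = (c' + 1) ^ card I"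
  define n where "n = D * d"
  define b where "b = D * d + n * c'"
  define A where "A = {..D} \<times> box_monoms I n"
  \<comment> \<open>All products have total degree \<open>D\<close> in p and q, so that dividing a
    relation by q^D later yields a polynomial equation for p / q.\<close>
  define u where "u = (\<lambda>(i, \<alpha>). p ^ i * q ^ (D - i) * monom_eval \<theta> \<alpha>)"
  have finA: "finite A" using fin by (simp add: A_def finite_box_monoms)
  have finE: "finite (box_monoms Z b)" using fin by (simp add: finite_box_monoms)
  have keys_u: "Poly_Mapping.keys (u a) \<subseteq> box_monoms Z b" if aA: "a \<in> A" for a
  proof -
    obtain i \<alpha> where a: "a = (i, \<alpha>)" "i \<le> D" "\<alpha> \<in> box_monoms I n"
      using aA by (auto simp: A_def)
    have "Poly_Mapping.keys (p ^ i * q ^ (D - i)) \<subseteq> box_monoms Z (i * d + (D - i) * d)"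
      by (intro keys_mult_box_monoms keys_power_box_monoms d)
    also have "i * d + (D - i) * d = D * d"
      using a by (simp flip: add_mult_distrib)
    finally have pq: "Poly_Mapping.keys (p ^ i * q ^ (D - i)) \<subseteq> box_monoms Z (D * d)" .
    have "monom_eval \<theta> \<alpha> = (\<Prod>v\<in>I. \<theta> v ^ Poly_Mapping.lookup \<alpha> v)"
      using a fin by (intro monom_eval_superset) (auto simp: box_monoms_def)
    moreover have "Poly_Mapping.keys (\<Prod>v\<in>I. \<theta> v ^ Poly_Mapping.lookup \<alpha> v)
        \<subseteq> box_monoms Z (\<Sum>v\<in>I. Poly_Mapping.lookup \<alpha> v * d)"
      by (intro keys_prod_box_monoms keys_power_box_monoms d)
    moreover have "(\<Sum>v\<in>I. Poly_Mapping.lookup \<alpha> v * d) \<le> (\<Sum>v\<in>I. n * d)"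
      using a by (intro sum_mono mult_right_mono) (auto simp: box_monoms_def)
    then have "(\<Sum>v\<in>I. Poly_Mapping.lookup \<alpha> v * d) \<le> n * c'"
      by (simp add: c'_def mult_ac)
    ultimately have "Poly_Mapping.keys (monom_eval \<theta> \<alpha>) \<subseteq> box_monoms Z (n * c')"
      using box_monoms_mono by (metis order_trans)
    then show ?thesis
      unfolding a(1) u_def b_def prod.case by (intro keys_mult_box_monoms pq)
  qed
  have "card (box_monoms Z b) = (b + 1) ^ card Z" using fin by (simp add: card_box_monoms)
  also have "\<dots> \<le> (b + 1) ^ card I" using card by (intro power_increasing) auto
  also have "\<dots> \<le> ((c' + 1) * (n + 1)) ^ card I"
    by (intro power_mono) (auto simp: b_def n_def algebra_simps)
  also have "\<dots> = D * (n + 1) ^ card I" by (simp only: D_def power_mult_distrib)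
  also have "\<dots> < (D + 1) * (n + 1) ^ card I" by simp
  also have "\<dots> = card A" using fin by (simp add: A_def card_cartesian_product card_box_monoms)
  finally obtain c where c: "\<exists>a\<in>A. c a \<noteq> 0"
    "\<forall>x\<in>box_monoms Z b. (\<Sum>a\<in>A. c a * Poly_Mapping.lookup (u a) x) = 0"
    using homogeneous_system_solution[OF finE finA, of "\<lambda>a x. Poly_Mapping.lookup (u a) x"] by blast
  have zero: "(\<Sum>a\<in>A. Const (c a) * u a) = 0"
  proof (rule poly_mapping_eqI)
    fix x
    show "Poly_Mapping.lookup (\<Sum>a\<in>A. Const (c a) * u a) x = Poly_Mapping.lookup 0 x"
    proof (cases "x \<in> box_monoms Z b")
      case True
      then show ?thesis using c(2) by (simp add: lookup_sum lookup_Const_mult)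
    next
      case False
      then have "Poly_Mapping.lookup (u a) x = 0" if "a \<in> A" for a
        using keys_u[OF that] by (auto simp: in_keys_iff)
      then show ?thesis by (simp add: lookup_sum lookup_Const_mult)
    qed
  qed
  define P where "P i = (\<Sum>\<alpha>\<in>box_monoms I n. Poly_Mapping.single \<alpha> (c (i, \<alpha>)))" for i
  have lP: "Poly_Mapping.lookup (P i) \<alpha> = (if \<alpha> \<in> box_monoms I n then c (i, \<alpha>) else 0)" for i \<alpha>
    using fin by (simp add: P_def lookup_sum lookup_single when_def finite_box_monoms)
  have kP: "Poly_Mapping.keys (P i) \<subseteq> box_monoms I n" for i
    by (auto simp: in_keys_iff lP split: if_splits)
  have "vars (P i) \<subseteq> I" for i
    using kP[of i] by (fastforce simp: vars_def box_monoms_def)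
  moreover have "\<exists>i\<le>D. P i \<noteq> 0"
  proof -
    obtain i \<alpha> where "i \<le> D" "\<alpha> \<in> box_monoms I n" "c (i, \<alpha>) \<noteq> 0"
      using c(1) by (auto simp: A_def)
    then have "Poly_Mapping.lookup (P i) \<alpha> \<noteq> 0" by (simp add: lP)
    then show ?thesis using \<open>i \<le> D\<close> by (intro exI[of _ i]) auto
  qed
  moreover have "(\<Sum>i\<le>D. p ^ i * q ^ (D - i) * eval_mpoly Const \<theta> (P i)) = (\<Sum>a\<in>A. Const (c a) * u a)"
  proof -
    have "eval_mpoly Const \<theta> (P i) = (\<Sum>\<alpha>\<in>box_monoms I n. Const (c (i, \<alpha>)) * monom_eval \<theta> \<alpha>)" for i
      using fin by (subst eval_mpoly_superset[OF _ _ kP]) (simp_all add: finite_box_monoms lP)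
    then have "(\<Sum>i\<le>D. p ^ i * q ^ (D - i) * eval_mpoly Const \<theta> (P i))
        = (\<Sum>i\<le>D. \<Sum>\<alpha>\<in>box_monoms I n. Const (c (i, \<alpha>)) * u (i, \<alpha>))"
      by (simp add: u_def sum_distrib_left mult_ac)
    also have "\<dots> = (\<Sum>a\<in>A. Const (c a) * u a)"
      unfolding A_def by (simp add: sum.cartesian_product)
    finally show ?thesis .
  qed
  ultimately show ?thesis using zero by (intro exI[of _ D] exI[of _ P]) auto
qed

section \<open>The transcendence basis\<close>

lemma is_subfield_hull: "is_subfield (is_subfield hull X)"
  by (rule hull_in) (auto simp: is_subfield_def)

context
  fixes S :: "'f::field set"
  assumes S: "is_subfield S"
begin

lemma subfield_sum: "(\<And>i. i \<in> A \<Longrightarrow> f i \<in> S) \<Longrightarrow> sum f A \<in> S"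
  using S by (induction A rule: infinite_finite_induct) (auto simp: is_subfield_def)

lemma subfield_prod: "(\<And>i. i \<in> A \<Longrightarrow> f i \<in> S) \<Longrightarrow> prod f A \<in> S"
  using S by (induction A rule: infinite_finite_induct) (auto simp: is_subfield_def)

lemma subfield_eval_mpoly:
  assumes "\<And>c. \<phi> c \<in> S" "\<And>v. v \<in> vars p \<Longrightarrow> f v \<in> S"
  shows "eval_mpoly \<phi> f p \<in> S"
  unfolding eval_mpoly_def
proof (rule subfield_sum)
  fix m assume m: "m \<in> Poly_Mapping.keys p"
  have "f v ^ k \<in> S" if "v \<in> Poly_Mapping.keys m" for v k
  proof -
    have "v \<in> vars p" using m that by (auto simp: vars_def)
    then show ?thesis using subfield_prod[of "{..<k}" "\<lambda>_. f v"] assms(2) by simp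
  qed
  then have "(\<Prod>v\<in>Poly_Mapping.keys m. f v ^ Poly_Mapping.lookup m v) \<in> S"
    by (rule subfield_prod)
  then show "\<phi> (Poly_Mapping.lookup p m) * (\<Prod>v\<in>Poly_Mapping.keys m. f v ^ Poly_Mapping.lookup m v) \<in> S"
    using S assms(1) by (auto simp: is_subfield_def)
qed

end

definition slice_vars :: "nat \<Rightarrow> nat \<Rightarrow> tvar set" where
  "slice_vars g r = insert (TVar 0 0 0)
     ({TVar 1 i i | i. i < g} \<union> {TVar l i j | l i j. 2 \<le> l \<and> l \<le> r \<and> i \<le> j \<and> j < g})"

lemma vars_to_slice:
  assumes "p \<in> T_ring g r"
  shows "vars (to_slice p) \<subseteq> slice_vars g r"
  unfolding to_slice_def
proof (rule vars_eval_mpoly)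
  fix v assume "v \<in> vars p"
  then have "v \<in> tvars g r" using assms by (auto simp: T_ring_def)
  then obtain l i j where "v = TVar l i j" "l \<le> r" "i \<le> j" "j < g" by (auto simp: tvars_def)
  then show "vars (slice_coord v :: (tvar, 'a) mpoly) \<subseteq> slice_vars g r"
    by (auto simp: slice_vars_def)
qed

lemma finite_slice_vars: "finite (slice_vars g r)"
proof (rule finite_subset)
  \<comment> \<open>The bound r + 1 covers the matrix index 1 also for r = 0.\<close>
  show "slice_vars g r \<subseteq> (\<lambda>(l, i, j). TVar l i j) ` ({..r + 1} \<times> {..g} \<times> {..g})"
    by (force simp: slice_vars_def image_iff)
qed auto

lemma Delta3I:
  assumes "a + k + b = g" "2 \<le> l" "l \<le> r"
  shows "Poly_Mapping.single 0 b + Poly_Mapping.single 1 a + Poly_Mapping.single l k \<in> Delta3 g r"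
proof -
  define m where "m = Poly_Mapping.single 0 b + Poly_Mapping.single 1 a + Poly_Mapping.single l k"
  have lk: "Poly_Mapping.lookup m x = (if x = 0 then b else if x = 1 then a else if x = l then k else 0)" for x
    using assms by (auto simp: m_def lookup_add lookup_single when_def)
  have "(\<Sum>i\<le>r. Poly_Mapping.lookup m i) = (\<Sum>i\<in>{0, 1, l}. Poly_Mapping.lookup m i)"
    using assms by (intro sum.mono_neutral_right) (auto simp: lk)
  also have "\<dots> = g" using assms by (simp add: lk)
  finally have "(\<Sum>i\<le>r. Poly_Mapping.lookup m i) = g" .
  moreover have "Poly_Mapping.keys m \<subseteq> {..r}"
    using assms by (auto simp: in_keys_iff lk split: if_splits)
  ultimately have "m \<in> Delta3 g r"
    by (auto simp: Delta3_def Delta_def lk split: if_splits)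
  then show ?thesis by (simp only: m_def)
qed

lemma card_slice_vars_le:
  assumes "r \<ge> 2"
  shows "card (slice_vars g r) \<le> card (Delta3 g r)"
proof -
  \<comment> \<open>An injection into the exponents: the entry (i, j) of T^(l) goes to the exponent
    with a block of label l on rows i to j, the i-th diagonal entry of T^(1) to the one with m_1 = i
    + 1 and no block, and the scalar to the one with m_1 = 0. The zero summands bring all values
    into the form of \<open>Delta3I\<close>.\<close>
  define h where "h = (\<lambda>TVar l i j \<Rightarrow>
     if l = 0 then Poly_Mapping.single 0 g + Poly_Mapping.single 1 0 + Poly_Mapping.single 2 0
     else if l = 1 then Poly_Mapping.single 0 (g - 1 - i) + Poly_Mapping.single 1 (i + 1) + Poly_Mapping.single 2 0
     else Poly_Mapping.single 0 (g - 1 - j) + Poly_Mapping.single 1 i + Poly_Mapping.single l (j - i + 1 :: nat))"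
  have fin: "finite (Delta3 g r)"
    using finite_Delta[of g r] by (simp add: Delta3_def)
  have sub: "h ` slice_vars g r \<subseteq> Delta3 g r"
    using assms unfolding slice_vars_def h_def
    by (auto simp del: single_zero intro!: Delta3I[unfolded One_nat_def])
  have inj: "inj_on h (slice_vars g r)"
  proof (rule inj_onI)
    fix v v' assume vv: "v \<in> slice_vars g r" "v' \<in> slice_vars g r" and eq: "h v = h v'"
    obtain l i j l' i' j' where v: "v = TVar l i j" "v' = TVar l' i' j'"
      by (cases v, cases v')
    have "Poly_Mapping.lookup (h v) x = Poly_Mapping.lookup (h v') x" for x by (simp add: eq)
    from this[of 0] this[of 1] this[of l] this[of l'] show "v = v'"
      using vv unfolding v slice_vars_def h_def
      by (auto simp: lookup_add lookup_single when_def split: if_splits)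
  qed
  show ?thesis by (rule card_inj_on_le[OF inj sub fin])
qed

text \<open>The counting argument gives a homogeneous relation between p, q and the
  \<open>Theta g r m\<close> after restriction to the slice. Its lift \<open>H\<close> is an
  invariant with zero restriction, so it vanishes by \<open>to_slice_eq_0D\<close>. Division by q^D
  makes p / q a root of \<open>Q\<close>, and \<open>Q\<close> is nonzero because independence keeps
  some coefficient \<open>G i\<close> from vanishing.\<close>

lemma algebraic_over_Thetas:
  fixes g r :: nat
  defines "\<phi> \<equiv> (\<lambda>c :: 'k::alg_closed_field. to_fract (Const c :: (tvar, 'k) mpoly))"
  assumes g: "g \<ge> 1" and r: "r \<ge> 2"
    and x: "x \<in> Frac (SL_invariants g r)"
  shows "algebraic_over (is_subfield hull (range \<phi> \<union> {to_fract (Theta g r m) | m. m \<in> Delta3 g r})) x"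
proof -
  interpret R: comm_ring_hom "to_slice :: (tvar, 'k) mpoly \<Rightarrow> _" by (rule comm_ring_hom_to_slice)
  interpret F: comm_ring_hom "to_fract :: (tvar, 'k) mpoly \<Rightarrow> _" by (rule comm_ring_hom_to_fract)
  interpret C: comm_ring_hom "Const :: 'k \<Rightarrow> (tvar, 'k) mpoly" by (rule comm_ring_hom_Const)
  let ?\<Theta> = "Theta g r :: _ \<Rightarrow> (tvar, 'k) mpoly"
  let ?S = "is_subfield hull (range \<phi> \<union> {to_fract (?\<Theta> m) | m. m \<in> Delta3 g r})"
  obtain p q where pq: "p \<in> SL_invariants g r" "q \<in> SL_invariants g r" "q \<noteq> 0" "x = Fract p q"
    using x by (auto simp: Frac_def)
  have fin: "finite (Delta3 g r)" using finite_Delta[of g r] by (simp add: Delta3_def)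
  have sv: "vars (to_slice f) \<subseteq> slice_vars g r" if "f \<in> SL_invariants g r" for f :: "(tvar, 'k) mpoly"
    using that by (intro vars_to_slice) (simp add: SL_invariants_def)
  have "\<exists>D P. (\<forall>i\<le>D. vars (P i) \<subseteq> Delta3 g r) \<and> (\<exists>i\<le>D. P i \<noteq> 0) \<and>
    (\<Sum>i\<le>D. to_slice p ^ i * to_slice q ^ (D - i) * eval_mpoly Const (\<lambda>m. to_slice (?\<Theta> m)) (P i)) = 0"
    by (rule ex_homogeneous_relation[OF finite_slice_vars fin card_slice_vars_le[OF r] sv[OF pq(1)] sv[OF pq(2)]
        sv[OF Theta_in_SL_invariants]])
  then obtain D P where DP: "(\<forall>i\<le>D. vars (P i) \<subseteq> Delta3 g r) \<and> (\<exists>i\<le>D. P i \<noteq> 0) \<and>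
    (\<Sum>i\<le>D. to_slice p ^ i * to_slice q ^ (D - i) * eval_mpoly Const (\<lambda>m. to_slice (?\<Theta> m)) (P i)) = 0"
    by (elim exE) (rule that)
  note varsP = conjunct1[OF DP] and P_ne_0 = conjunct1[OF conjunct2[OF DP]] and rel = conjunct2[OF conjunct2[OF DP]]
  define G where "G i = eval_mpoly Const ?\<Theta> (P i)" for i
  define H where "H = (\<Sum>i\<le>D. p ^ i * q ^ (D - i) * G i)"
  have Ginv: "G i \<in> SL_invariants g r" for i
    unfolding G_def eval_mpoly_def
    by (intro SL_invariants_sum SL_invariants_mult SL_invariants_prod SL_invariants_power
        Const_in_SL_invariants Theta_in_SL_invariants)
  have "H \<in> SL_invariants g r"
    unfolding H_def by (intro SL_invariants_sum SL_invariants_mult SL_invariants_power pq Ginv)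
  moreover have "to_slice H = 0"
  proof -
    have "to_slice (G i) = eval_mpoly Const (\<lambda>m. to_slice (?\<Theta> m)) (P i)" for i
      unfolding G_def by (rule R.hom_eval_mpoly) (simp add: to_slice_def)
    then show ?thesis by (simp add: H_def hom_distribs rel)
  qed
  ultimately have H0: "H = 0" using to_slice_eq_0D[OF g] by blast
  define Q where "Q = (\<Sum>i\<le>D. monom (to_fract (G i)) i)"
  have coeff: "poly.coeff Q i = (if i \<le> D then to_fract (G i) else 0)" for i
    by (simp add: Q_def coeff_sum)
  have "Q \<noteq> 0"
  proof -
    obtain i where i: "i \<le> D" "P i \<noteq> 0" using P_ne_0 by blast
    then have "vars (P i) \<subseteq> Delta3 g r" using varsP by simp
    then have "G i \<noteq> 0"
      unfolding G_def using Theta_family_independent[OF g r] i(2) by blast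
    then have "poly.coeff Q i \<noteq> 0" using i by (simp add: coeff)
    then show ?thesis by auto
  qed
  moreover have "poly.coeff Q i \<in> ?S" for i
  proof -
    have "to_fract (G i) \<in> ?S" if "i \<le> D"
    proof -
      have "to_fract (G i) = eval_mpoly \<phi> (\<lambda>m. to_fract (?\<Theta> m)) (P i)"
        unfolding G_def by (rule F.hom_eval_mpoly) (simp add: \<phi>_def)
      moreover have "eval_mpoly \<phi> (\<lambda>m. to_fract (?\<Theta> m)) (P i) \<in> ?S"
        using varsP that by (intro subfield_eval_mpoly is_subfield_hull hull_inc) auto
      ultimately show ?thesis by simp
    qed
    moreover have "0 \<in> ?S" using is_subfield_hull by (auto simp: is_subfield_def)
    ultimately show ?thesis by (simp add: coeff)
  qed
  moreover have "poly Q x = 0"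
  proof -
    let ?q = "to_fract q"
    have q0: "?q \<noteq> 0" using pq by simp
    have "poly Q x * ?q ^ D = (\<Sum>i\<le>D. to_fract (G i) * (to_fract p / ?q) ^ i * ?q ^ D)"
      by (simp add: Q_def poly_sum poly_monom pq(4) Fract_conv_to_fract sum_distrib_right)
    also have "\<dots> = (\<Sum>i\<le>D. to_fract p ^ i * ?q ^ (D - i) * to_fract (G i))"
      using q0 by (intro sum.cong refl) (simp add: power_divide power_diff)
    also have "\<dots> = to_fract H" by (simp add: H_def hom_distribs)
    finally show ?thesis using q0 by (simp add: H0)
  qed
  ultimately show ?thesis unfolding algebraic_over_def by blast
qed

text \<open>In \<open>algebraically_independent\<close> the elements of the set are themselves the
  variables, whereas \<open>Theta_family_independent\<close> uses the exponents m. Choosing for each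
  element b an exponent \<open>h b\<close> renames \<open>p\<close> to \<open>P\<close>; sending m
  back to its own element recovers \<open>p\<close> from \<open>P\<close>, so \<open>P = 0\<close>
  forces \<open>p = 0\<close>.\<close>

lemma Thetas_algebraically_independent:
  fixes g r :: nat
  assumes g: "g \<ge> 1" and r: "r \<ge> 2"
  shows "algebraically_independent (\<lambda>c :: 'k::alg_closed_field. to_fract (Const c :: (tvar, 'k) mpoly))
     {to_fract (Theta g r m) | m. m \<in> Delta3 g r}"
  unfolding algebraically_independent_def
proof (intro allI impI)
  let ?\<phi> = "\<lambda>c :: 'k. to_fract (Const c :: (tvar, 'k) mpoly)"
  let ?\<Theta> = "Theta g r :: _ \<Rightarrow> (tvar, 'k) mpoly"
  let ?B = "{to_fract (?\<Theta> m) | m. m \<in> Delta3 g r}"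
  interpret F: comm_ring_hom "to_fract :: (tvar, 'k) mpoly \<Rightarrow> _" by (rule comm_ring_hom_to_fract)
  interpret C: comm_ring_hom "Const :: 'k \<Rightarrow> (tvar, 'k) mpoly" by (rule comm_ring_hom_Const)
  interpret CF: comm_ring_hom ?\<phi> by unfold_locales (simp_all add: hom_distribs)
  fix p :: "((tvar, 'k) mpoly fract, 'k) mpoly"
  assume p: "vars p \<subseteq> ?B" "eval_mpoly ?\<phi> (\<lambda>b. b) p = 0"
  define h where "h b = (SOME m. m \<in> Delta3 g r \<and> to_fract (?\<Theta> m) = b)" for b
  have h: "h b \<in> Delta3 g r \<and> to_fract (?\<Theta> (h b)) = b" if "b \<in> ?B" for b
    unfolding h_def by (rule someI_ex) (use that in auto)
  define P :: "(nat \<Rightarrow>\<^sub>0 nat, 'k) mpoly" where "P = eval_mpoly Const (\<lambda>b. Var (h b)) p"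
  have varsP: "vars P \<subseteq> Delta3 g r"
    unfolding P_def using p(1) h by (intro vars_eval_mpoly) auto
  have "to_fract (eval_mpoly Const ?\<Theta> P) = eval_mpoly ?\<phi> (\<lambda>m. to_fract (?\<Theta> m)) P"
    by (rule F.hom_eval_mpoly) simp
  also have "\<dots> = eval_mpoly ?\<phi> (\<lambda>b. to_fract (?\<Theta> (h b))) p"
    unfolding P_def by (subst eval_mpoly_eval_mpoly[OF CF.comm_ring_hom_axioms]) simp
  also have "\<dots> = eval_mpoly ?\<phi> (\<lambda>b. b) p"
    using p(1) h by (intro eval_mpoly_cong) blast
  finally have "eval_mpoly Const ?\<Theta> P = 0" using p(2) by simp
  then have P0: "P = 0" by (rule Theta_family_independent[OF g r varsP])
  interpret C': comm_ring_hom "Const :: 'k \<Rightarrow> ((tvar, 'k) mpoly fract, 'k) mpoly" by (rule comm_ring_hom_Const)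
  have "p = eval_mpoly Const Var p" by simp
  also have "\<dots> = eval_mpoly Const (\<lambda>b. Var (to_fract (?\<Theta> (h b)))) p"
  proof (rule eval_mpoly_cong)
    fix b assume "b \<in> vars p"
    then have "to_fract (?\<Theta> (h b)) = b" using p(1) h by blast
    then show "(Var b :: ((tvar, 'k) mpoly fract, 'k) mpoly) = Var (to_fract (?\<Theta> (h b)))" by simp
  qed
  also have "\<dots> = eval_mpoly Const (\<lambda>m. Var (to_fract (?\<Theta> m))) P"
    unfolding P_def by (subst eval_mpoly_eval_mpoly[OF comm_ring_hom_Const]) simp
  also have "\<dots> = 0" by (simp add: P0 eval_mpoly_def)
  finally show "p = 0" .
qed

theorem theorem31:
  fixes g r :: nat
  assumes "g \<ge> 1" and "r \<ge> 2"
  shows "transcendence_basis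
           (\<lambda>c :: 'k::alg_closed_field. to_fract (Const c :: (tvar, 'k) mpoly))
           (Frac (SL_invariants g r))
           {to_fract (Theta g r m) | m. m \<in> Delta3 g r}"
  unfolding transcendence_basis_def
proof (intro conjI ballI)
  have "to_fract p \<in> Frac (SL_invariants g r)" if "p \<in> SL_invariants g r" for p :: "(tvar, 'k) mpoly"
    unfolding Frac_def to_fract_def
    by (intro CollectI exI[of _ p] exI[of _ 1] conjI refl that one_in_SL_invariants one_neq_zero)
  then show "{to_fract (Theta g r m) | m. m \<in> Delta3 g r} \<subseteq> Frac (SL_invariants g r :: (tvar, 'k) mpoly set)"
    using Theta_in_SL_invariants by auto
qed (rule Thetas_algebraically_independent[OF assms], rule algebraic_over_Thetas[OF assms])

end
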